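(* Let $(M^{2n+1},\phi,\xi,\eta,g)$ be an almost $\alpha$-paracosymplectic manifold and let $\mathcal{A}X=-\nabla_X\xi$. Then for all vector fields $X,Y$ on $M$, $$(\nabla_{\phi X}\phi)\phi Y-(\nabla_X\phi)Y-\eta(Y)\mathcal{A}\phi X-2\alpha\bigl(g(X,\phi Y)\xi+\eta(Y)\phi X\bigr)=0 .$$
   Context: An almost paracontact metric manifold is a smooth manifold $M$ of dimension $2n+1$ with a $(1,1)$-tensor field $\phi$, a vector field $\xi$, a 1-form $\eta$ and a pseudo-Riemannian metric $g$ of signature $(n+1,n)$ such that $\eta(\xi)=1$, $\phi^2=\mathrm{Id}-\eta\otimes\xi$, the eigendistributions of $\phi|_{\ker\eta}$ for the eigenvalues $+1$ and $-1$ both have rank $n$, and $g(\phi X,\phi Y)=-g(X,Y)+\eta(X)\eta(Y)$ (hence $\eta(X)=g(X,\xi)$, $\phi\xi=0$, $\eta\circ\phi=0$). Its fundamental 2-form is $\Phi(X,Y)=g(\phi X,Y)$. It is almost $\alpha$-paracosymplectic, where $\alpha$ is a smooth real function on $M$ (possibly constant), if $d\eta=0$ and $d\Phi=2\alpha\,\eta\wedge\Phi$ (with $d$ and $\wedge$ normalized compatibly, so that the cyclic sum of $(\nabla_X\Phi)(Y,Z)$ equals $2\alpha$ times the cyclic sum of $\eta(X)\Phi(Y,Z)$). $\nabla$ is the Levi-Civita connection of $g$. *)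

theory Defs
  imports "HOL-Analysis.Analysis" "HOL-Library.Function_Algebras"
begin

text \<open>
  Functions with values in a real vector space form a real vector space. This gives
  \<^const>\<open>span\<close>, \<^const>\<open>independent\<close> and \<^const>\<open>dim\<close> for tangent vectors, which are functionals on
  real functions, and pointwise addition for vector fields.
\<close>

instantiation "fun" :: (type, real_vector) real_vector
begin

definition scaleR_fun :: "real \<Rightarrow> ('a \<Rightarrow> 'b) \<Rightarrow> 'a \<Rightarrow> 'b" where
  "scaleR_fun c f = (\<lambda>x. c *\<^sub>R f x)"

instance
  by standard (simp_all add: scaleR_fun_def fun_eq_iff scaleR_add_right scaleR_add_left)

end


section \<open>Smooth manifolds\<close>

text \<open>
  On an open set \<open>S\<close> of a Euclidean space, \<open>Ck_on k S\<close> is the class of \<open>k\<close> times continuously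
  differentiable maps: by finite-dimensionality it is enough that all directional derivatives
  are of class \<open>k - 1\<close>.
\<close>

primrec Ck_on :: "nat \<Rightarrow> 'e::euclidean_space set \<Rightarrow> ('e \<Rightarrow> 'f::real_normed_vector) \<Rightarrow> bool" where
  "Ck_on 0 S f \<longleftrightarrow> continuous_on S f"
| "Ck_on (Suc k) S f \<longleftrightarrow>
     (\<forall>x\<in>S. f differentiable (at x)) \<and> (\<forall>v. Ck_on k S (\<lambda>x. frechet_derivative f (at x) v))"

definition smooth_on :: "'e::euclidean_space set \<Rightarrow> ('e \<Rightarrow> 'f::real_normed_vector) \<Rightarrow> bool" where
  "smooth_on S f \<longleftrightarrow> (\<forall>k. Ck_on k S f)"

type_synonym ('m, 'e) chart = "'m set \<times> ('m \<Rightarrow> 'e)"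

definition smooth_atlas ::
  "('m::{t2_space, second_countable_topology}, 'e::euclidean_space) chart set \<Rightarrow> bool" where
  "smooth_atlas A \<longleftrightarrow>
     (\<Union>(U, \<psi>)\<in>A. U) = UNIV \<and>
     (\<forall>(U, \<psi>)\<in>A. open U \<and> open (\<psi> ` U) \<and> homeomorphism U (\<psi> ` U) \<psi> (inv_into U \<psi>)) \<and>
     (\<forall>(U, \<psi>)\<in>A. \<forall>(V, \<theta>)\<in>A. smooth_on (\<psi> ` (U \<inter> V)) (\<theta> \<circ> inv_into U \<psi>))"

definition smooth_functions ::
  "('m::{t2_space, second_countable_topology}, 'e::euclidean_space) chart set \<Rightarrow> ('m \<Rightarrow> real) set" where
  "smooth_functions A = {f. \<forall>(U, \<psi>)\<in>A. smooth_on (\<psi> ` U) (f \<circ> inv_into U \<psi>)}"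


section \<open>Tangent vectors, vector fields and tensor fields\<close>

type_synonym 'm tvec = "('m \<Rightarrow> real) \<Rightarrow> real"
type_synonym 'm vfield = "'m \<Rightarrow> 'm tvec"

text \<open>
  Tangent vectors at \<open>p\<close> are the derivations at \<open>p\<close> of the algebra of smooth functions. The value
  on non-smooth functions is fixed to be \<open>0\<close>, so that equal derivations are equal as functions.
\<close>

definition tangent_space ::
  "('m::{t2_space, second_countable_topology}, 'e::euclidean_space) chart set \<Rightarrow> 'm \<Rightarrow> 'm tvec set" where
  "tangent_space A p = {v.
     (\<forall>f\<in>smooth_functions A. \<forall>h\<in>smooth_functions A. v (f + h) = v f + v h) \<and>
     (\<forall>c. \<forall>f\<in>smooth_functions A. v (c *\<^sub>R f) = c * v f) \<and>
     (\<forall>f\<in>smooth_functions A. \<forall>h\<in>smooth_functions A. v (f * h) = f p * v h + h p * v f) \<and>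
     (\<forall>f. f \<notin> smooth_functions A \<longrightarrow> v f = 0)}"

definition act :: "'m vfield \<Rightarrow> ('m \<Rightarrow> real) \<Rightarrow> 'm \<Rightarrow> real" where
  "act X f = (\<lambda>p. X p f)"

definition vector_fields ::
  "('m::{t2_space, second_countable_topology}, 'e::euclidean_space) chart set \<Rightarrow> 'm vfield set" where
  "vector_fields A = {X. (\<forall>p. X p \<in> tangent_space A p) \<and>
     (\<forall>f\<in>smooth_functions A. act X f \<in> smooth_functions A)}"

definition lie_bracket :: "'m vfield \<Rightarrow> 'm vfield \<Rightarrow> 'm vfield" where
  "lie_bracket X Y = (\<lambda>p f. X p (act Y f) - Y p (act X f))"

definition fscale :: "('m \<Rightarrow> real) \<Rightarrow> 'm vfield \<Rightarrow> 'm vfield" (infixr "\<odot>" 75) where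
  "a \<odot> X = (\<lambda>p. a p *\<^sub>R X p)"

text \<open>
  A tensor field is given by its pointwise values, which are relevant only on the tangent spaces;
  it is smooth if it takes smooth vector fields to a smooth vector field or a smooth function.
\<close>

definition ap :: "('m \<Rightarrow> 'm tvec \<Rightarrow> 'b) \<Rightarrow> 'm vfield \<Rightarrow> 'm \<Rightarrow> 'b" where
  "ap T X = (\<lambda>p. T p (X p))"

definition ap2 :: "('m \<Rightarrow> 'm tvec \<Rightarrow> 'm tvec \<Rightarrow> 'b) \<Rightarrow> 'm vfield \<Rightarrow> 'm vfield \<Rightarrow> 'm \<Rightarrow> 'b" where
  "ap2 T X Y = (\<lambda>p. T p (X p) (Y p))"

definition linear_map_on :: "'a::real_vector set \<Rightarrow> ('a \<Rightarrow> 'b::real_vector) \<Rightarrow> bool" where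
  "linear_map_on V f \<longleftrightarrow>
     (\<forall>u\<in>V. \<forall>v\<in>V. f (u + v) = f u + f v) \<and> (\<forall>c. \<forall>v\<in>V. f (c *\<^sub>R v) = c *\<^sub>R f v)"

definition one_form ::
  "('m::{t2_space, second_countable_topology}, 'e::euclidean_space) chart set \<Rightarrow>
     ('m \<Rightarrow> 'm tvec \<Rightarrow> real) \<Rightarrow> bool" where
  "one_form A \<eta> \<longleftrightarrow>
     (\<forall>p. linear_map_on (tangent_space A p) (\<eta> p)) \<and>
     (\<forall>X\<in>vector_fields A. ap \<eta> X \<in> smooth_functions A)"

definition tensor_1_1 ::
  "('m::{t2_space, second_countable_topology}, 'e::euclidean_space) chart set \<Rightarrow>
     ('m \<Rightarrow> 'm tvec \<Rightarrow> 'm tvec) \<Rightarrow> bool" where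
  "tensor_1_1 A T \<longleftrightarrow>
     (\<forall>p. linear_map_on (tangent_space A p) (T p) \<and>
          T p ` tangent_space A p \<subseteq> tangent_space A p) \<and>
     (\<forall>X\<in>vector_fields A. ap T X \<in> vector_fields A)"

definition tensor_0_2 ::
  "('m::{t2_space, second_countable_topology}, 'e::euclidean_space) chart set \<Rightarrow>
     ('m \<Rightarrow> 'm tvec \<Rightarrow> 'm tvec \<Rightarrow> real) \<Rightarrow> bool" where
  "tensor_0_2 A T \<longleftrightarrow>
     (\<forall>p. \<forall>u\<in>tangent_space A p. linear_map_on (tangent_space A p) (T p u) \<and>
          linear_map_on (tangent_space A p) (\<lambda>v. T p v u)) \<and>
     (\<forall>X\<in>vector_fields A. \<forall>Y\<in>vector_fields A. ap2 T X Y \<in> smooth_functions A)"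

text \<open>
  The exterior derivative and the wedge product are normalized without the factors \<open>1/2\<close> and
  \<open>1/3\<close>, so that for a 2-form \<open>\<omega>\<close> and a torsion-free connection both \<open>d\<omega>\<close> and \<open>\<eta> \<and> \<omega>\<close> are plain
  cyclic sums, of \<open>(\<nabla>\<^sub>X \<omega>)(Y, Z)\<close> and \<open>\<eta>(X) \<omega>(Y, Z)\<close>.
\<close>

definition ext_deriv_1 ::
  "('m \<Rightarrow> 'm tvec \<Rightarrow> real) \<Rightarrow> 'm vfield \<Rightarrow> 'm vfield \<Rightarrow> 'm \<Rightarrow> real" where
  "ext_deriv_1 \<eta> X Y = act X (ap \<eta> Y) - act Y (ap \<eta> X) - ap \<eta> (lie_bracket X Y)"

definition ext_deriv_2 ::
  "('m \<Rightarrow> 'm tvec \<Rightarrow> 'm tvec \<Rightarrow> real) \<Rightarrow> 'm vfield \<Rightarrow> 'm vfield \<Rightarrow> 'm vfield \<Rightarrow> 'm \<Rightarrow> real" where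
  "ext_deriv_2 \<omega> X Y Z =
     act X (ap2 \<omega> Y Z) - act Y (ap2 \<omega> X Z) + act Z (ap2 \<omega> X Y)
     - ap2 \<omega> (lie_bracket X Y) Z + ap2 \<omega> (lie_bracket X Z) Y - ap2 \<omega> (lie_bracket Y Z) X"

definition wedge_1_2 ::
  "('m \<Rightarrow> 'm tvec \<Rightarrow> real) \<Rightarrow> ('m \<Rightarrow> 'm tvec \<Rightarrow> 'm tvec \<Rightarrow> real) \<Rightarrow>
     'm vfield \<Rightarrow> 'm vfield \<Rightarrow> 'm vfield \<Rightarrow> 'm \<Rightarrow> real" where
  "wedge_1_2 \<eta> \<omega> X Y Z =
     ap \<eta> X * ap2 \<omega> Y Z - ap \<eta> Y * ap2 \<omega> X Z + ap \<eta> Z * ap2 \<omega> X Y"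


section \<open>Pseudo-Riemannian metrics and the Levi-Civita connection\<close>

text \<open>
  A symmetric bilinear form on \<open>V\<close> has signature \<open>(r, s)\<close> if \<open>V\<close> has an orthogonal basis with
  \<open>r\<close> vectors of positive and \<open>s\<close> vectors of negative square; in particular it is nondegenerate.
\<close>

definition has_signature ::
  "'a::real_vector set \<Rightarrow> ('a \<Rightarrow> 'a \<Rightarrow> real) \<Rightarrow> nat \<Rightarrow> nat \<Rightarrow> bool" where
  "has_signature V b r s \<longleftrightarrow> (\<exists>P N.
     finite P \<and> finite N \<and> P \<inter> N = {} \<and> card P = r \<and> card N = s \<and>
     independent (P \<union> N) \<and> span (P \<union> N) = V \<and>
     (\<forall>u\<in>P \<union> N. \<forall>v\<in>P \<union> N. u \<noteq> v \<longrightarrow> b u v = 0) \<and>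
     (\<forall>u\<in>P. b u u > 0) \<and> (\<forall>u\<in>N. b u u < 0))"

definition pseudo_riemannian_metric ::
  "('m::{t2_space, second_countable_topology}, 'e::euclidean_space) chart set \<Rightarrow> nat \<Rightarrow> nat \<Rightarrow>
     ('m \<Rightarrow> 'm tvec \<Rightarrow> 'm tvec \<Rightarrow> real) \<Rightarrow> bool" where
  "pseudo_riemannian_metric A r s g \<longleftrightarrow>
     tensor_0_2 A g \<and>
     (\<forall>p. \<forall>u\<in>tangent_space A p. \<forall>v\<in>tangent_space A p. g p u v = g p v u) \<and>
     (\<forall>p. has_signature (tangent_space A p) (g p) r s)"

definition affine_connection ::
  "('m::{t2_space, second_countable_topology}, 'e::euclidean_space) chart set \<Rightarrow>
     ('m vfield \<Rightarrow> 'm vfield \<Rightarrow> 'm vfield) \<Rightarrow> bool" where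
  "affine_connection A D \<longleftrightarrow>
     (\<forall>X\<in>vector_fields A. \<forall>Y\<in>vector_fields A. D X Y \<in> vector_fields A) \<and>
     (\<forall>X\<in>vector_fields A. \<forall>X'\<in>vector_fields A. \<forall>Y\<in>vector_fields A.
        D (X + X') Y = D X Y + D X' Y) \<and>
     (\<forall>f\<in>smooth_functions A. \<forall>X\<in>vector_fields A. \<forall>Y\<in>vector_fields A.
        D (f \<odot> X) Y = f \<odot> D X Y) \<and>
     (\<forall>X\<in>vector_fields A. \<forall>Y\<in>vector_fields A. \<forall>Y'\<in>vector_fields A.
        D X (Y + Y') = D X Y + D X Y') \<and>
     (\<forall>f\<in>smooth_functions A. \<forall>X\<in>vector_fields A. \<forall>Y\<in>vector_fields A.
        D X (f \<odot> Y) = act X f \<odot> Y + f \<odot> D X Y)"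

definition levi_civita_connection ::
  "('m::{t2_space, second_countable_topology}, 'e::euclidean_space) chart set \<Rightarrow>
     ('m \<Rightarrow> 'm tvec \<Rightarrow> 'm tvec \<Rightarrow> real) \<Rightarrow> ('m vfield \<Rightarrow> 'm vfield \<Rightarrow> 'm vfield) \<Rightarrow> bool" where
  "levi_civita_connection A g D \<longleftrightarrow>
     affine_connection A D \<and>
     (\<forall>X\<in>vector_fields A. \<forall>Y\<in>vector_fields A. D X Y - D Y X = lie_bracket X Y) \<and>
     (\<forall>X\<in>vector_fields A. \<forall>Y\<in>vector_fields A. \<forall>Z\<in>vector_fields A.
        act X (ap2 g Y Z) = ap2 g (D X Y) Z + ap2 g Y (D X Z))"

definition cov_deriv_1_1 ::
  "('m vfield \<Rightarrow> 'm vfield \<Rightarrow> 'm vfield) \<Rightarrow> ('m \<Rightarrow> 'm tvec \<Rightarrow> 'm tvec) \<Rightarrow>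
     'm vfield \<Rightarrow> 'm vfield \<Rightarrow> 'm vfield" where
  "cov_deriv_1_1 D T X Y = D X (ap T Y) - ap T (D X Y)"


section \<open>Almost paracontact metric structures\<close>

definition almost_paracontact_metric ::
  "('m::{t2_space, second_countable_topology}, 'e::euclidean_space) chart set \<Rightarrow> nat \<Rightarrow>
     ('m \<Rightarrow> 'm tvec \<Rightarrow> 'm tvec) \<Rightarrow> 'm vfield \<Rightarrow> ('m \<Rightarrow> 'm tvec \<Rightarrow> real) \<Rightarrow>
     ('m \<Rightarrow> 'm tvec \<Rightarrow> 'm tvec \<Rightarrow> real) \<Rightarrow> bool" where
  "almost_paracontact_metric A n \<phi> \<xi> \<eta> g \<longleftrightarrow>
     smooth_atlas A \<and> DIM('e) = 2 * n + 1 \<and>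
     tensor_1_1 A \<phi> \<and> \<xi> \<in> vector_fields A \<and> one_form A \<eta> \<and>
     pseudo_riemannian_metric A (n + 1) n g \<and>
     (\<forall>p. \<eta> p (\<xi> p) = 1) \<and>
     (\<forall>p. \<forall>v\<in>tangent_space A p. \<phi> p (\<phi> p v) = v - \<eta> p v *\<^sub>R \<xi> p) \<and>
     (\<forall>p. dim {v\<in>tangent_space A p. \<eta> p v = 0 \<and> \<phi> p v = v} = n) \<and>
     (\<forall>p. dim {v\<in>tangent_space A p. \<eta> p v = 0 \<and> \<phi> p v = - v} = n) \<and>
     (\<forall>p. \<forall>u\<in>tangent_space A p. \<forall>v\<in>tangent_space A p.
        g p (\<phi> p u) (\<phi> p v) = - g p u v + \<eta> p u * \<eta> p v)"

definition fundamental_form ::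
  "('m \<Rightarrow> 'm tvec \<Rightarrow> 'm tvec) \<Rightarrow> ('m \<Rightarrow> 'm tvec \<Rightarrow> 'm tvec \<Rightarrow> real) \<Rightarrow>
     'm \<Rightarrow> 'm tvec \<Rightarrow> 'm tvec \<Rightarrow> real" where
  "fundamental_form \<phi> g = (\<lambda>p u v. g p (\<phi> p u) v)"

definition almost_alpha_paracosymplectic ::
  "('m::{t2_space, second_countable_topology}, 'e::euclidean_space) chart set \<Rightarrow> nat \<Rightarrow>
     ('m \<Rightarrow> 'm tvec \<Rightarrow> 'm tvec) \<Rightarrow> 'm vfield \<Rightarrow> ('m \<Rightarrow> 'm tvec \<Rightarrow> real) \<Rightarrow>
     ('m \<Rightarrow> 'm tvec \<Rightarrow> 'm tvec \<Rightarrow> real) \<Rightarrow> ('m \<Rightarrow> real) \<Rightarrow> bool" where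
  "almost_alpha_paracosymplectic A n \<phi> \<xi> \<eta> g \<alpha> \<longleftrightarrow>
     almost_paracontact_metric A n \<phi> \<xi> \<eta> g \<and> \<alpha> \<in> smooth_functions A \<and>
     (\<forall>X\<in>vector_fields A. \<forall>Y\<in>vector_fields A. ext_deriv_1 \<eta> X Y = 0) \<and>
     (\<forall>X\<in>vector_fields A. \<forall>Y\<in>vector_fields A. \<forall>Z\<in>vector_fields A.
        ext_deriv_2 (fundamental_form \<phi> g) X Y Z =
        2 *\<^sub>R (\<alpha> * wedge_1_2 \<eta> (fundamental_form \<phi> g) X Y Z))"

definition shape_operator ::
  "('m vfield \<Rightarrow> 'm vfield \<Rightarrow> 'm vfield) \<Rightarrow> 'm vfield \<Rightarrow> 'm vfield \<Rightarrow> 'm vfield" where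
  "shape_operator D \<xi> X = - D X \<xi>"

end

theory Submission
  imports Defs "HOL-Computational_Algebra.Polynomial"
begin

text \<open>
  Write \<open>T(X, Y, Z) = g((\<nabla>\<^sub>X \<phi>) Y, Z)\<close>; since \<open>\<phi>\<close> is \<open>g\<close>-skew and \<open>\<nabla>\<close> is metric, this is the
  covariant derivative of the fundamental form, and it is skew in \<open>Y\<close> and \<open>Z\<close>
  (\<open>cov_phi_form_skew\<close>). Two facts about \<open>T\<close> give the identity.

  Differentiating \<open>\<phi>\<^sup>2 = Id - \<eta> \<otimes> \<xi>\<close> shows that in \<open>T(X, \<phi>Y, Z)\<close> the map \<open>\<phi>\<close> can be
  moved from the second to the third slot, up to terms in \<open>\<nabla>\<xi>\<close>
  (\<open>cov_phi_form_phi_middle\<close>, \<open>cov_phi_form_phi_phi\<close>). The structure equation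
  \<open>d\<Phi> = 2\<alpha> \<eta> \<and> \<Phi>\<close> computes the cyclic sum \<open>S(X, Y, Z)\<close> of \<open>T\<close>
  (\<open>cov_phi_form_cyclic\<close>). In the combination
  \<open>S(\<phi>X, \<phi>Y, Z) + S(\<phi>X, Y, \<phi>Z) - S(X, \<phi>Y, \<phi>Z) - S(X, Y, Z)\<close>
  moving \<open>\<phi>\<close> cancels every term that is not differentiated along \<open>X\<close> or \<open>\<phi>X\<close>, and what is
  left is \<open>2 (T(\<phi>X, \<phi>Y, Z) - T(X, Y, Z))\<close> plus terms in \<open>\<nabla>\<xi>\<close>. Because \<open>d\<eta> = 0\<close> makes
  \<open>\<nabla>\<xi>\<close> self-adjoint (\<open>connection_xi_self_adjoint\<close>), all of these cancel except the one with
  \<open>\<A>\<phi>X\<close>. The result, \<open>cov_phi_form_phi_conjugate\<close>, is the theorem paired with an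
  arbitrary vector field \<open>Z\<close>.

  To remove \<open>Z\<close>, the nondegeneracy of \<open>g\<close> at each point is combined with the fact that every
  tangent vector is the value of a global smooth vector field (\<open>tangent_vector_extends\<close>). For this
  fact, the coordinate fields of a chart are multiplied by a bump function. Their values at the point are
  linearly independent, because they are biorthogonal to the differentials of the cut-off
  coordinate functions. The signature of \<open>g\<close> says that the space of derivations has the same
  dimension as the model space, so they span it; this replaces the usual Taylor expansion
  argument that derivations are combinations of partial derivatives.
\<close>

section \<open>Calculus of smooth maps between Euclidean spaces\<close>

text \<open>
  For an open set a \<open>C\<^sup>k\<close> condition depends only on the values on the set, although
  \<^const>\<open>frechet_derivative\<close> is taken of the total function.
\<close>
lemma Ck_on_cong:
  fixes f g :: "'a::euclidean_space \<Rightarrow> 'b::real_normed_vector"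
  assumes "open S" "\<And>x. x \<in> S \<Longrightarrow> f x = g x" "Ck_on k S f"
  shows "Ck_on k S g"
  using assms(2,3)
proof (induction k arbitrary: f g)
  case 0
  then show ?case using continuous_on_cong[of S S f g] by simp
next
  case (Suc k)
  have der: "(g has_derivative frechet_derivative f (at x)) (at x)" if "x \<in> S" for x
    by (rule has_derivative_transform_within_open[where f = f, OF _ \<open>open S\<close> that])
       (use Suc.prems that in \<open>auto simp: frechet_derivative_works\<close>)
  then have "frechet_derivative f (at x) = frechet_derivative g (at x)" if "x \<in> S" for x
    using that by (metis frechet_derivative_at)
  then have "Ck_on k S (\<lambda>x. frechet_derivative g (at x) v)" for v
    using Suc.IH[of "\<lambda>x. frechet_derivative f (at x) v"] Suc.prems(2) by simp
  with der show ?case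
    by (auto simp: differentiable_def)
qed

text \<open>
  The recursive clause of \<^const>\<open>Ck_on\<close> speaks about \<^const>\<open>frechet_derivative\<close>; in the closure
  proofs below the derivative is known as an explicit formula, and this is the form of the clause
  that they use.
\<close>
lemma Ck_on_Suc_intro:
  assumes der: "\<And>x. x \<in> S \<Longrightarrow> (f has_derivative f' x) (at x)" and "open S"
    and "\<And>v. Ck_on k S (\<lambda>x. f' x v)"
  shows "Ck_on (Suc k) S f"
proof -
  have "f' x = frechet_derivative f (at x)" if "x \<in> S" for x
    using der[OF that] by (rule frechet_derivative_at)
  then have "Ck_on k S (\<lambda>x. frechet_derivative f (at x) v)" for v
    by (intro Ck_on_cong[OF \<open>open S\<close> _ assms(3)[of v]]) simp
  with der show ?thesis
    by (auto simp: differentiable_def)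
qed

lemma Ck_on_SucD:
  assumes "Ck_on (Suc k) S f"
  shows "x \<in> S \<Longrightarrow> (f has_derivative frechet_derivative f (at x)) (at x)"
    and "Ck_on k S (\<lambda>x. frechet_derivative f (at x) v)"
  using assms by (metis Ck_on.simps(2) frechet_derivative_works)+

lemma Ck_on_Suc_imp: "Ck_on (Suc k) S f \<Longrightarrow> Ck_on k S f"
proof (induction k arbitrary: f)
  case 0
  then show ?case
    by (auto simp: continuous_on_eq_continuous_at differentiable_imp_continuous_within
        intro!: differentiable_imp_continuous_on differentiable_at_imp_differentiable_on)
next
  case (Suc k)
  then show ?case by (metis Ck_on.simps(2))
qed

lemma Ck_on_locally:
  assumes "\<And>x. x \<in> S \<Longrightarrow> \<exists>T. open T \<and> x \<in> T \<and> Ck_on k T f"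
  shows "Ck_on k S f"
  using assms
proof (induction k arbitrary: f)
  case 0
  then show ?case
    by (metis Ck_on.simps(1) continuous_at_imp_continuous_on continuous_on_eq_continuous_at)
next
  case (Suc k)
  then show ?case by (metis Ck_on.simps(2))
qed

lemma Ck_on_subset: "Ck_on k S f \<Longrightarrow> T \<subseteq> S \<Longrightarrow> Ck_on k T f"
proof (induction k arbitrary: f)
  case 0
  then show ?case using continuous_on_subset by auto
next
  case (Suc k)
  then show ?case by (metis Ck_on.simps(2) subsetD)
qed

lemma Ck_on_const: "open S \<Longrightarrow> Ck_on k S (\<lambda>x. c)"
proof (induction k arbitrary: c)
  case (Suc k)
  show ?case by (rule Ck_on_Suc_intro[where f' = "\<lambda>x v. 0"]) (use Suc in auto)
qed simp

lemma Ck_on_bounded_linear: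
  assumes "bounded_linear L" "open S" "Ck_on k S f"
  shows "Ck_on k S (\<lambda>x. L (f x))"
  using assms(3)
proof (induction k arbitrary: f)
  case 0
  then show ?case using assms(1) by (auto intro: bounded_linear.continuous_on)
next
  case (Suc k)
  have "((\<lambda>x. L (f x)) has_derivative (\<lambda>v. L (frechet_derivative f (at x) v))) (at x)" if "x \<in> S" for x
    by (rule bounded_linear.has_derivative[OF assms(1) Ck_on_SucD(1)[OF Suc.prems that]])
  then show ?case
    by (rule Ck_on_Suc_intro) (use assms(2) Suc.IH Ck_on_SucD(2)[OF Suc.prems] in auto)
qed

lemma Ck_on_id: "open S \<Longrightarrow> Ck_on k S (\<lambda>x. x)"
proof (cases k)
  case (Suc j)
  assume "open S"
  show ?thesis unfolding Suc
    by (rule Ck_on_Suc_intro[where f' = "\<lambda>x v. v"]) (use \<open>open S\<close> in \<open>auto intro: Ck_on_const\<close>)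
qed simp

lemma Ck_on_add:
  assumes "open S" "Ck_on k S f" "Ck_on k S g"
  shows "Ck_on k S (\<lambda>x. f x + g x)"
  using assms(2,3)
proof (induction k arbitrary: f g)
  case 0
  then show ?case by (auto intro: continuous_on_add)
next
  case (Suc k)
  note d = Ck_on_SucD[OF Suc.prems(1)] Ck_on_SucD[OF Suc.prems(2)]
  show ?case
    by (rule Ck_on_Suc_intro[where
          f' = "\<lambda>x v. frechet_derivative f (at x) v + frechet_derivative g (at x) v"])
       (use Suc.IH d assms(1) in \<open>auto intro!: has_derivative_add\<close>)
qed

lemma Ck_on_sum:
  assumes "open S" "finite I" "\<And>i. i \<in> I \<Longrightarrow> Ck_on k S (f i)"
  shows "Ck_on k S (\<lambda>x. \<Sum>i\<in>I. f i x)"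
  using assms(2,3)
proof (induction I)
  case empty
  then show ?case using Ck_on_const[OF \<open>open S\<close>, of k 0] by simp
next
  case (insert i I)
  then show ?case using Ck_on_add[OF \<open>open S\<close>, of k "f i"] by simp
qed

lemma Ck_on_mult:
  fixes f g :: "'a::euclidean_space \<Rightarrow> real"
  assumes "open S" "Ck_on k S f" "Ck_on k S g"
  shows "Ck_on k S (\<lambda>x. f x * g x)"
  using assms(2,3)
proof (induction k arbitrary: f g)
  case 0
  then show ?case by (auto intro: continuous_on_mult)
next
  case (Suc k)
  note d = Ck_on_SucD[OF Suc.prems(1)] Ck_on_SucD[OF Suc.prems(2)]
  show ?case
    by (rule Ck_on_Suc_intro[where
          f' = "\<lambda>x v. f x * frechet_derivative g (at x) v + frechet_derivative f (at x) v * g x"])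
       (use Suc d assms(1) in
          \<open>auto intro!: has_derivative_mult Ck_on_add Suc.IH intro: Ck_on_Suc_imp simp del: Ck_on.simps\<close>)
qed

text \<open>
  By the chain rule \<open>D(f \<circ> g)(x) v = (\<Sum>b. D f (g x) b * (D g x v \<bullet> b))\<close>. The expansion in the basis
  turns the derivative into sums of products of the \<open>C\<^sup>k\<close> functions \<open>(\<lambda>y. D f y b) \<circ> g\<close> and
  \<open>\<lambda>x. D g x v \<bullet> b\<close>, so that induction on \<open>k\<close> applies to \<open>f\<close>.
\<close>
lemma Ck_on_compose:
  fixes f :: "'b::euclidean_space \<Rightarrow> real" and g :: "'a::euclidean_space \<Rightarrow> 'b"
  assumes "open S" "open T" "g ` S \<subseteq> T" "Ck_on k T f" "Ck_on k S g"
  shows "Ck_on k S (\<lambda>x. f (g x))"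
  using assms(4,5)
proof (induction k arbitrary: f)
  case 0
  then show ?case
    using assms(3) by (auto intro: continuous_on_compose2)
next
  case (Suc k)
  note f = Ck_on_SucD[OF Suc.prems(1)] and g = Ck_on_SucD[OF Suc.prems(2)]
  let ?f' = "\<lambda>x v. \<Sum>b\<in>Basis.
    frechet_derivative f (at (g x)) b * (frechet_derivative g (at x) v \<bullet> b)"
  have "((\<lambda>x. f (g x)) has_derivative ?f' x) (at x)" if "x \<in> S" for x
  proof -
    have gx: "g x \<in> T" using that assms(3) by blast
    have "linear (frechet_derivative f (at (g x)))"
      using f(1)[OF gx] has_derivative_linear by blast
    then have "frechet_derivative f (at (g x)) (\<Sum>b\<in>Basis. (w \<bullet> b) *\<^sub>R b) =
      (\<Sum>b\<in>Basis. frechet_derivative f (at (g x)) b * (w \<bullet> b))" for w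
      by (simp only: linear_sum linear_cmul real_scaleR_def mult.commute)
    then have "frechet_derivative f (at (g x)) w =
      (\<Sum>b\<in>Basis. frechet_derivative f (at (g x)) b * (w \<bullet> b))" for w
      unfolding euclidean_representation .
    then have "(\<lambda>v. frechet_derivative f (at (g x)) (frechet_derivative g (at x) v)) = ?f' x"
      by (rule ext)
    with diff_chain_at[OF g(1)[OF that] f(1)[OF gx]] show ?thesis
      by (simp only: o_def)
  qed
  moreover have "Ck_on k S (\<lambda>x. ?f' x v)" for v
  proof (rule Ck_on_sum[OF \<open>open S\<close> finite_Basis], rule Ck_on_mult[OF \<open>open S\<close>])
    fix b :: 'b
    show "Ck_on k S (\<lambda>x. frechet_derivative f (at (g x)) b)"
      using Suc.IH[OF f(2) Ck_on_Suc_imp[OF Suc.prems(2)]] .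
    show "Ck_on k S (\<lambda>x. frechet_derivative g (at x) v \<bullet> b)"
      using Ck_on_bounded_linear[OF bounded_linear_inner_left \<open>open S\<close> g(2)] .
  qed
  ultimately show ?case
    using \<open>open S\<close> by (intro Ck_on_Suc_intro[where f' = ?f'])
qed

lemma smooth_on_cong:
  assumes "open S" "\<And>x. x \<in> S \<Longrightarrow> f x = g x" "smooth_on S f"
  shows "smooth_on S g"
  using assms Ck_on_cong unfolding smooth_on_def by blast

lemma smooth_on_subset: "smooth_on S f \<Longrightarrow> T \<subseteq> S \<Longrightarrow> smooth_on T f"
  using Ck_on_subset unfolding smooth_on_def by blast

lemma smooth_on_locally:
  assumes "\<And>x. x \<in> S \<Longrightarrow> \<exists>T. open T \<and> x \<in> T \<and> smooth_on T f"
  shows "smooth_on S f"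
  unfolding smooth_on_def
proof
  fix k
  show "Ck_on k S f"
    by (rule Ck_on_locally) (use assms in \<open>auto simp: smooth_on_def\<close>)
qed

lemma smooth_on_const: "open S \<Longrightarrow> smooth_on S (\<lambda>x. c)"
  unfolding smooth_on_def using Ck_on_const by blast

lemma smooth_on_inner_right: "open S \<Longrightarrow> smooth_on S (\<lambda>x. x \<bullet> b)"
  unfolding smooth_on_def using Ck_on_bounded_linear[OF bounded_linear_inner_left _ Ck_on_id] by blast

lemma smooth_on_add:
  "open S \<Longrightarrow> smooth_on S f \<Longrightarrow> smooth_on S g \<Longrightarrow> smooth_on S (\<lambda>x. f x + g x)"
  unfolding smooth_on_def using Ck_on_add by blast

lemma smooth_on_mult:
  fixes f g :: "'a::euclidean_space \<Rightarrow> real"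
  shows "open S \<Longrightarrow> smooth_on S f \<Longrightarrow> smooth_on S g \<Longrightarrow> smooth_on S (\<lambda>x. f x * g x)"
  unfolding smooth_on_def using Ck_on_mult by blast

lemma smooth_on_sum:
  "open S \<Longrightarrow> finite I \<Longrightarrow> (\<And>i. i \<in> I \<Longrightarrow> smooth_on S (f i)) \<Longrightarrow> smooth_on S (\<lambda>x. \<Sum>i\<in>I. f i x)"
  unfolding smooth_on_def using Ck_on_sum by blast

lemma smooth_on_compose:
  fixes f :: "'b::euclidean_space \<Rightarrow> real" and g :: "'a::euclidean_space \<Rightarrow> 'b"
  shows "open S \<Longrightarrow> open T \<Longrightarrow> g ` S \<subseteq> T \<Longrightarrow> smooth_on T f \<Longrightarrow> smooth_on S g
    \<Longrightarrow> smooth_on S (\<lambda>x. f (g x))"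
  unfolding smooth_on_def using Ck_on_compose by blast

lemma smooth_on_has_derivative:
  "smooth_on S f \<Longrightarrow> x \<in> S \<Longrightarrow> (f has_derivative frechet_derivative f (at x)) (at x)"
  unfolding smooth_on_def using Ck_on_SucD(1) by blast

lemma smooth_on_frechet_derivative:
  "smooth_on S f \<Longrightarrow> smooth_on S (\<lambda>x. frechet_derivative f (at x) v)"
  unfolding smooth_on_def using Ck_on_SucD(2) by blast

section \<open>Bump functions\<close>

text \<open>
  The functions \<open>q(1/x) exp(-1/x)\<close>, extended by \<open>0\<close> to \<open>x \<le> 0\<close>, with an arbitrary polynomial \<open>q\<close>:
  unlike \<open>exp(-1/x)\<close> alone, this family is closed under differentiation, so that its members are
  smooth by a plain induction.
\<close>
definition flat_exp :: "real poly \<Rightarrow> real \<Rightarrow> real" where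
  "flat_exp q x = (if x > 0 then poly q (1 / x) * exp (- (1 / x)) else 0)"

lemma tendsto_poly_div_exp_0: "((\<lambda>y::real. poly q y / exp y) \<longlongrightarrow> 0) at_top"
proof -
  have "((\<lambda>y. \<Sum>i\<le>degree q. coeff q i * (y ^ i / exp y)) \<longlongrightarrow> (\<Sum>i\<le>degree q. coeff q i * 0)) at_top"
    by (rule tendsto_sum, rule tendsto_mult[OF tendsto_const tendsto_power_div_exp_0])
  then show ?thesis
    by (simp add: poly_altdef sum_divide_distrib)
qed

text \<open>
  From the right the difference quotient is \<open>y q(y) exp(-y)\<close> with \<open>y = 1/h \<rightarrow> \<infinity>\<close>, and the
  exponential dominates every polynomial.
\<close>
lemma flat_exp_has_derivative_0: "(flat_exp q has_real_derivative 0) (at 0)"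
proof -
  have "((\<lambda>h. flat_exp q h / h) \<longlongrightarrow> 0) (at_left 0)"
    by (rule tendsto_eventually)
       (auto simp: eventually_at_left_field flat_exp_def intro!: exI[of _ "-1"])
  moreover have "((\<lambda>h. flat_exp q h / h) \<longlongrightarrow> 0) (at_right 0)"
  proof -
    have "((\<lambda>h. poly (pCons 0 q) (inverse h) / exp (inverse h)) \<longlongrightarrow> 0) (at_right 0)"
      by (rule filterlim_compose[OF tendsto_poly_div_exp_0 filterlim_inverse_at_top_right])
    moreover have "\<forall>\<^sub>F h in at_right 0. poly (pCons 0 q) (inverse h) / exp (inverse h) = flat_exp q h / h"
      by (auto simp: eventually_at_right_field flat_exp_def exp_minus field_simps intro!: exI[of _ 1])
    ultimately show ?thesis by (rule Lim_transform_eventually)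
  qed
  ultimately show ?thesis
    by (simp add: DERIV_def filterlim_at_split flat_exp_def)
qed

lemma flat_exp_has_derivative:
  "(flat_exp q has_real_derivative flat_exp ([:0,0,1:] * (q - pderiv q)) x) (at x)"
proof -
  consider "x < 0" | "x = 0" | "x > 0" by linarith
  then show ?thesis
  proof cases
    case 1
    have "((\<lambda>x. 0) has_real_derivative 0) (at x)" by simp
    then have "(flat_exp q has_real_derivative 0) (at x)"
      by (rule has_field_derivative_transform_within_open[where S = "{..<0}"])
         (use 1 in \<open>auto simp: flat_exp_def\<close>)
    with 1 show ?thesis by (simp add: flat_exp_def)
  next
    case 2
    then show ?thesis using flat_exp_has_derivative_0[of q] by (simp add: flat_exp_def)
  next
    case 3
    have "((\<lambda>x. poly q (1 / x) * exp (- (1 / x))) has_real_derivative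
      flat_exp ([:0,0,1:] * (q - pderiv q)) x) (at x)"
      using 3
      by (auto intro!: derivative_eq_intros DERIV_chain2[OF poly_DERIV] simp: flat_exp_def
          power2_eq_square divide_simps) (simp add: algebra_simps)
    then show ?thesis
      by (rule has_field_derivative_transform_within_open[where S = "{0<..}"])
         (use 3 in \<open>auto simp: flat_exp_def\<close>)
  qed
qed

lemma Ck_on_flat_exp: "Ck_on k UNIV (flat_exp q)"
proof (induction k arbitrary: q)
  case 0
  then show ?case
    by (auto intro!: continuous_at_imp_continuous_on DERIV_isCont[OF flat_exp_has_derivative])
next
  case (Suc k)
  show ?case
    by (rule Ck_on_Suc_intro[where f' = "\<lambda>x v. flat_exp ([:0,0,1:] * (q - pderiv q)) x * v"])
     (use flat_exp_has_derivative Suc in \<open>auto intro!: Ck_on_mult Ck_on_const simp: has_field_derivative_def\<close>)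
qed

text \<open>
  The square of the distance keeps the argument of \<^const>\<open>flat_exp\<close> smooth at the centre; outside
  the ball the argument is negative.
\<close>
definition bump :: "'e::euclidean_space \<Rightarrow> real \<Rightarrow> 'e \<Rightarrow> real" where
  "bump c r y = flat_exp 1 (r\<^sup>2 - (norm (y - c))\<^sup>2)"

lemma smooth_on_bump: "smooth_on UNIV (bump c r)"
proof -
  have "smooth_on UNIV (\<lambda>y. r\<^sup>2 + (- 1) * (\<Sum>b\<in>Basis. (y \<bullet> b + - (c \<bullet> b)) * (y \<bullet> b + - (c \<bullet> b))))"
    by (rule smooth_on_add smooth_on_const smooth_on_mult smooth_on_sum finite_Basis
        smooth_on_inner_right open_UNIV)+
  moreover have "r\<^sup>2 + (- 1) * (\<Sum>b\<in>Basis. (y \<bullet> b + - (c \<bullet> b)) * (y \<bullet> b + - (c \<bullet> b))) = r\<^sup>2 - (norm (y - c))\<^sup>2"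
    for y
    unfolding power2_norm_eq_inner euclidean_inner[of "y - c" "y - c"] by (simp add: inner_diff_left)
  ultimately have "smooth_on UNIV (\<lambda>y. r\<^sup>2 - (norm (y - c))\<^sup>2)"
    by (simp only:)
  moreover have "smooth_on UNIV (flat_exp 1)"
    by (simp add: smooth_on_def Ck_on_flat_exp)
  ultimately have "smooth_on UNIV (\<lambda>y. flat_exp 1 (r\<^sup>2 - (norm (y - c))\<^sup>2))"
    using smooth_on_compose[OF open_UNIV open_UNIV subset_UNIV] by blast
  then show ?thesis unfolding bump_def .
qed

lemma bump_pos: "r > 0 \<Longrightarrow> bump c r c > 0"
  by (simp add: bump_def flat_exp_def)

lemma bump_eq_0: "r > 0 \<Longrightarrow> y \<notin> cball c r \<Longrightarrow> bump c r y = 0"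
proof -
  assume "r > 0" "y \<notin> cball c r"
  then have "r \<le> norm (y - c)"
    by (simp add: dist_norm norm_minus_commute)
  with \<open>r > 0\<close> have "r\<^sup>2 \<le> (norm (y - c))\<^sup>2"
    by (intro power_mono) auto
  then show ?thesis
    by (simp add: bump_def flat_exp_def)
qed

section \<open>Linear and bilinear maps on a subspace\<close>

lemma linear_map_on_sum:
  assumes "linear_map_on V f" "subspace V" "finite B" "B \<subseteq> V"
  shows "f (\<Sum>u\<in>B. c u *\<^sub>R u) = (\<Sum>u\<in>B. c u *\<^sub>R f u)"
  using assms(3,4)
proof (induction B)
  case empty
  have "f (0 *\<^sub>R 0) = 0 *\<^sub>R f 0"
    using assms(1,2) subspace_0 unfolding linear_map_on_def by blast
  then show ?case by simp
next
  case (insert w B)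
  then have "(\<Sum>u\<in>B. c u *\<^sub>R u) \<in> V" "c w *\<^sub>R w \<in> V" "w \<in> V"
    using assms(2) by (auto intro!: subspace_sum subspace_scale)
  then show ?case
    using insert assms(1) unfolding linear_map_on_def by simp
qed

lemma linear_map_on_diff:
  assumes f: "linear_map_on V f" and "subspace V" "u \<in> V" "v \<in> V"
  shows "f (u - v) = f u - f v"
proof -
  have "f (u + (- 1) *\<^sub>R v) = f u + f ((- 1) *\<^sub>R v)"
    using assms subspace_scale unfolding linear_map_on_def by blast
  also have "f ((- 1) *\<^sub>R v) = (- 1) *\<^sub>R f v"
    using assms unfolding linear_map_on_def by blast
  finally show ?thesis by simp
qed

text \<open>
  Pairing \<open>v\<close> with a member \<open>w\<close> of the orthogonal basis isolates the \<open>w\<close>-coefficient of \<open>v\<close>, up to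
  the nonzero factor \<open>b w w\<close>.
\<close>
lemma has_signature_nondegenerate:
  assumes sig: "has_signature V b r s"
    and lin: "\<And>w. w \<in> V \<Longrightarrow> linear_map_on V (\<lambda>v. b v w)"
    and v: "v \<in> V" and 0: "\<And>w. w \<in> V \<Longrightarrow> b v w = 0"
  shows "v = 0"
proof -
  from sig obtain P N where fin: "finite (P \<union> N)" and V: "span (P \<union> N) = V"
    and orth: "\<And>u w. u \<in> P \<union> N \<Longrightarrow> w \<in> P \<union> N \<Longrightarrow> u \<noteq> w \<Longrightarrow> b u w = 0"
    and "\<forall>u\<in>P. b u u > 0" "\<forall>u\<in>N. b u u < 0"
    unfolding has_signature_def by auto
  then have square: "b w w \<noteq> 0" if "w \<in> P \<union> N" for w using that by force
  have sub: "P \<union> N \<subseteq> V" "subspace V" using V span_superset subspace_span by blast+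
  obtain c where c: "v = (\<Sum>u\<in>P \<union> N. c u *\<^sub>R u)"
    using v V span_finite[OF fin] by auto
  have "c w = 0" if w: "w \<in> P \<union> N" for w
  proof -
    have "0 = b v w" using 0 w sub by auto
    also have "\<dots> = (\<Sum>u\<in>P \<union> N. c u * b u w)"
      using linear_map_on_sum[OF lin sub(2) fin sub(1)] w sub(1) c by auto
    also have "\<dots> = (\<Sum>u\<in>P \<union> N. if u = w then c w * b w w else 0)"
      using orth w by (intro sum.cong) auto
    also have "\<dots> = c w * b w w" using fin w by simp
    finally show ?thesis using square[OF w] by simp
  qed
  then show ?thesis using c by simp
qed

section \<open>Smooth functions and vector fields on a manifold\<close>

definition chart_extension :: "'m set \<Rightarrow> ('m \<Rightarrow> 'e) \<Rightarrow> ('e \<Rightarrow> real) \<Rightarrow> 'm \<Rightarrow> real" where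
  "chart_extension U \<psi> h = (\<lambda>q. if q \<in> U then h (\<psi> q) else 0)"

text \<open>
  The coordinate vector field \<open>\<kappa> \<partial>\<^sub>b\<close> of a chart. As for every tangent vector, its value on
  functions that are not smooth has to be \<open>0\<close>.
\<close>
definition cutoff_partial :: "('m::{t2_space, second_countable_topology}, 'e::euclidean_space) chart set \<Rightarrow>
    'm set \<Rightarrow> ('m \<Rightarrow> 'e) \<Rightarrow> ('e \<Rightarrow> real) \<Rightarrow> 'e \<Rightarrow> 'm vfield" where
  "cutoff_partial A U \<psi> \<kappa> b = (\<lambda>q f. if f \<in> smooth_functions A
     then chart_extension U \<psi> (\<lambda>y. \<kappa> y * frechet_derivative (f \<circ> inv_into U \<psi>) (at y) b) q else 0)"

locale smooth_manifold =
  fixes A :: "('m::{t2_space, second_countable_topology}, 'e::euclidean_space) chart set"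
  assumes atlas: "smooth_atlas A"
begin

lemma chart_props:
  assumes "(U, \<psi>) \<in> A"
  shows "open U" "open (\<psi> ` U)" "homeomorphism U (\<psi> ` U) \<psi> (inv_into U \<psi>)" "inj_on \<psi> U"
proof -
  show "open U" "open (\<psi> ` U)" and hom: "homeomorphism U (\<psi> ` U) \<psi> (inv_into U \<psi>)"
    using atlas assms unfolding smooth_atlas_def by auto
  from hom show "inj_on \<psi> U" by (metis homeomorphism_def inj_on_inverseI)
qed

lemma chart_covers: "\<exists>U \<psi>. (U, \<psi>) \<in> A \<and> p \<in> U"
proof -
  have "p \<in> (\<Union>(U, \<psi>)\<in>A. U)" using atlas unfolding smooth_atlas_def by auto
  then show ?thesis by auto
qed

lemma chart_transition_smooth:
  "(U, \<psi>) \<in> A \<Longrightarrow> (V, \<theta>) \<in> A \<Longrightarrow> smooth_on (\<theta> ` (V \<inter> U)) (\<psi> \<circ> inv_into V \<theta>)"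
  using atlas unfolding smooth_atlas_def by (metis (no_types, lifting) case_prodD)

lemma chart_image_open:
  assumes "(U, \<psi>) \<in> A" "open W"
  shows "open (\<psi> ` (U \<inter> W))"
proof -
  have "openin (top_of_set (\<psi> ` U)) (\<psi> ` (U \<inter> W))"
    by (rule homeomorphism_imp_open_map[OF chart_props(3)[OF assms(1)]]) (use assms(2) in auto)
  then show ?thesis
    using chart_props(2)[OF assms(1)] openin_open_eq by blast
qed

text \<open>
  The manifold is covered by the chart domain \<open>U\<close>, where the function is \<open>h\<close> in coordinates, and the
  complement of the compact set that corresponds to \<open>K\<close>, where it is \<open>0\<close>. The second set is open
  because compact subsets of a Hausdorff space are closed.
\<close>
lemma chart_extension_smooth:
  assumes U: "(U, \<psi>) \<in> A" and h: "smooth_on (\<psi> ` U) h"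
    and K: "compact K" "K \<subseteq> \<psi> ` U" and h0: "\<And>y. y \<in> \<psi> ` U \<Longrightarrow> y \<notin> K \<Longrightarrow> h y = 0"
  shows "chart_extension U \<psi> h \<in> smooth_functions A"
proof -
  let ?L = "inv_into U \<psi> ` K"
  have "continuous_on K (inv_into U \<psi>)"
    using chart_props(3)[OF U] K(2) unfolding homeomorphism_def
    by (metis continuous_on_subset)
  then have L: "closed ?L"
    using K(1) compact_continuous_image compact_imp_closed by blast
  have zero: "chart_extension U \<psi> h q = 0" if "q \<notin> ?L" for q
  proof (cases "q \<in> U")
    case True
    then have "inv_into U \<psi> (\<psi> q) = q" using chart_props(4)[OF U] by simp
    then have "\<psi> q \<notin> K" using that by (metis imageI)
    then show ?thesis using True h0 by (simp add: chart_extension_def)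
  qed (simp add: chart_extension_def)
  have "smooth_on (\<theta> ` V) (chart_extension U \<psi> h \<circ> inv_into V \<theta>)" if V: "(V, \<theta>) \<in> A" for V \<theta>
  proof (rule smooth_on_locally)
    have inv: "inv_into V \<theta> (\<theta> q) = q" if "q \<in> V" for q
      using that chart_props(4)[OF V] by simp
    fix y assume "y \<in> \<theta> ` V"
    then obtain q where q: "q \<in> V" "y = \<theta> q" by blast
    show "\<exists>T. open T \<and> y \<in> T \<and> smooth_on T (chart_extension U \<psi> h \<circ> inv_into V \<theta>)"
    proof (cases "q \<in> U")
      case True
      have op: "open (\<theta> ` (V \<inter> U))"
        by (rule chart_image_open[OF V chart_props(1)[OF U]])
      have "smooth_on (\<theta> ` (V \<inter> U)) (\<lambda>x. h ((\<psi> \<circ> inv_into V \<theta>) x))"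
        by (rule smooth_on_compose[OF op chart_props(2)[OF U] _ h chart_transition_smooth[OF U V]])
           (auto simp: inv)
      then have "smooth_on (\<theta> ` (V \<inter> U)) (chart_extension U \<psi> h \<circ> inv_into V \<theta>)"
        by (rule smooth_on_cong[OF op, rotated]) (auto simp: inv chart_extension_def)
      with op q True show ?thesis by blast
    next
      case False
      have "?L \<subseteq> U" using K(2) by (auto intro: inv_into_into)
      with False have "q \<notin> ?L" by blast
      have op: "open (\<theta> ` (V \<inter> - ?L))"
        by (rule chart_image_open[OF V]) (use L in auto)
      have "smooth_on (\<theta> ` (V \<inter> - ?L)) (chart_extension U \<psi> h \<circ> inv_into V \<theta>)"
        by (rule smooth_on_cong[OF op _ smooth_on_const[OF op, of 0]]) (auto simp: inv zero)
      with op q \<open>q \<notin> ?L\<close> show ?thesis by blast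
    qed
  qed
  then show ?thesis by (auto simp: smooth_functions_def)
qed

lemma smooth_functions_chart:
  "f \<in> smooth_functions A \<Longrightarrow> (U, \<psi>) \<in> A \<Longrightarrow> smooth_on (\<psi> ` U) (f \<circ> inv_into U \<psi>)"
  by (auto simp: smooth_functions_def)

lemma smooth_functions_add:
  assumes "f \<in> smooth_functions A" "h \<in> smooth_functions A"
  shows "f + h \<in> smooth_functions A"
  using assms smooth_on_add[OF chart_props(2)] by (fastforce simp: smooth_functions_def o_def)

lemma smooth_functions_mult:
  assumes "f \<in> smooth_functions A" "h \<in> smooth_functions A"
  shows "f * h \<in> smooth_functions A"
  using assms smooth_on_mult[OF chart_props(2)] by (fastforce simp: smooth_functions_def o_def)

lemma smooth_functions_const: "(\<lambda>p. c) \<in> smooth_functions A"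
  using smooth_on_const[OF chart_props(2)] by (fastforce simp: smooth_functions_def o_def)

lemma smooth_functions_scaleR:
  assumes "f \<in> smooth_functions A"
  shows "c *\<^sub>R f \<in> smooth_functions A"
proof -
  have "c *\<^sub>R f = (\<lambda>p. c) * f" by (simp add: fun_eq_iff scaleR_fun_def)
  then show ?thesis using smooth_functions_mult[OF smooth_functions_const assms] by simp
qed

lemma subspace_tangent_space: "subspace (tangent_space A p)"
  unfolding subspace_def tangent_space_def
  by (auto simp: scaleR_fun_def algebra_simps)

lemma vector_fields_0: "0 \<in> vector_fields A"
  using subspace_0[OF subspace_tangent_space] smooth_functions_const[of 0]
  by (simp add: vector_fields_def act_def)

lemma vector_fields_add:
  assumes "X \<in> vector_fields A" "Y \<in> vector_fields A"
  shows "X + Y \<in> vector_fields A"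
proof -
  have "act (X + Y) f = act X f + act Y f" for f by (simp add: act_def fun_eq_iff)
  then show ?thesis
    using assms subspace_add[OF subspace_tangent_space] smooth_functions_add
    by (simp add: vector_fields_def)
qed

lemma vector_fields_fscale:
  assumes "a \<in> smooth_functions A" "X \<in> vector_fields A"
  shows "a \<odot> X \<in> vector_fields A"
proof -
  have "act (a \<odot> X) f = a * act X f" for f by (simp add: act_def fun_eq_iff fscale_def scaleR_fun_def)
  then show ?thesis
    using assms subspace_scale[OF subspace_tangent_space] smooth_functions_mult
    by (simp add: vector_fields_def fscale_def)
qed

lemma vector_fields_uminus:
  assumes "X \<in> vector_fields A"
  shows "- X \<in> vector_fields A"
proof -
  have "- X = (\<lambda>p. - 1) \<odot> X" by (simp add: fscale_def fun_eq_iff)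
  then show ?thesis using vector_fields_fscale[OF smooth_functions_const assms] by simp
qed

lemma vector_fields_diff:
  assumes "X \<in> vector_fields A" "Y \<in> vector_fields A"
  shows "X - Y \<in> vector_fields A"
  using vector_fields_add[OF assms(1) vector_fields_uminus[OF assms(2)]] by simp

lemma vector_fields_tangent: "X \<in> vector_fields A \<Longrightarrow> X p \<in> tangent_space A p"
  by (simp add: vector_fields_def)

lemma cutoff_partial_vector_field:
  assumes U: "(U, \<psi>) \<in> A" and \<kappa>: "smooth_on (\<psi> ` U) \<kappa>"
    and K: "compact K" "K \<subseteq> \<psi> ` U" and \<kappa>0: "\<And>y. y \<in> \<psi> ` U \<Longrightarrow> y \<notin> K \<Longrightarrow> \<kappa> y = 0"
  shows "cutoff_partial A U \<psi> \<kappa> b \<in> vector_fields A"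
proof -
  have "cutoff_partial A U \<psi> \<kappa> b q \<in> tangent_space A q" for q
  proof (cases "q \<in> U")
    case False
    then show ?thesis
      by (simp add: cutoff_partial_def chart_extension_def tangent_space_def)
  next
    case True
    have inv: "inv_into U \<psi> (\<psi> q) = q" using True chart_props(4)[OF U] by simp
    let ?d = "\<lambda>f. frechet_derivative (f \<circ> inv_into U \<psi>) (at (\<psi> q))"
    have der: "((f \<circ> inv_into U \<psi>) has_derivative ?d f) (at (\<psi> q))" if "f \<in> smooth_functions A" for f
      by (rule smooth_on_has_derivative[OF smooth_functions_chart[OF that U]]) (use True in simp)
    have add: "?d (f + h) b = ?d f b + ?d h b" if "f \<in> smooth_functions A" "h \<in> smooth_functions A" for f h
    proof -
      have "((\<lambda>y. (f \<circ> inv_into U \<psi>) y + (h \<circ> inv_into U \<psi>) y) has_derivative (\<lambda>v. ?d f v + ?d h v)) (at (\<psi> q))"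
        by (rule has_derivative_add[OF der[OF that(1)] der[OF that(2)]])
      from frechet_derivative_at[OF this] show ?thesis by (simp add: o_def) metis
    qed
    have mult: "?d (f * h) b = f q * ?d h b + h q * ?d f b" if "f \<in> smooth_functions A" "h \<in> smooth_functions A" for f h
    proof -
      have "((\<lambda>y. (f \<circ> inv_into U \<psi>) y * (h \<circ> inv_into U \<psi>) y) has_derivative
         (\<lambda>v. (f \<circ> inv_into U \<psi>) (\<psi> q) * ?d h v + ?d f v * (h \<circ> inv_into U \<psi>) (\<psi> q))) (at (\<psi> q))"
        by (rule has_derivative_mult[OF der[OF that(1)] der[OF that(2)]])
      from fun_cong[OF frechet_derivative_at[OF this], of b] show ?thesis
        by (simp add: o_def times_fun_def inv mult.commute)
    qed
    have scale: "?d (c *\<^sub>R f) b = c * ?d f b" if "f \<in> smooth_functions A" for c f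
    proof -
      have "((\<lambda>y. c *\<^sub>R (f \<circ> inv_into U \<psi>) y) has_derivative (\<lambda>v. c *\<^sub>R ?d f v)) (at (\<psi> q))"
        by (rule has_derivative_scaleR_right[OF der[OF that]])
      from fun_cong[OF frechet_derivative_at[OF this], of b] show ?thesis
        by (simp add: o_def scaleR_fun_def)
    qed
    show ?thesis
      using True
      by (auto simp: tangent_space_def cutoff_partial_def chart_extension_def add mult scale
          smooth_functions_add smooth_functions_mult smooth_functions_scaleR algebra_simps)
  qed
  moreover have "act (cutoff_partial A U \<psi> \<kappa> b) f \<in> smooth_functions A" if f: "f \<in> smooth_functions A" for f
  proof -
    have "act (cutoff_partial A U \<psi> \<kappa> b) f =
      chart_extension U \<psi> (\<lambda>y. \<kappa> y * frechet_derivative (f \<circ> inv_into U \<psi>) (at y) b)"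
      using f by (simp add: act_def cutoff_partial_def)
    moreover have "\<dots> \<in> smooth_functions A"
    proof (rule chart_extension_smooth[OF U _ K])
      show "smooth_on (\<psi> ` U) (\<lambda>y. \<kappa> y * frechet_derivative (f \<circ> inv_into U \<psi>) (at y) b)"
        by (intro smooth_on_mult[OF chart_props(2)[OF U] \<kappa>] smooth_on_frechet_derivative
            smooth_functions_chart[OF f U])
    qed (simp add: \<kappa>0)
    ultimately show ?thesis by simp
  qed
  ultimately show ?thesis by (simp add: vector_fields_def)
qed

section \<open>Extension of tangent vectors\<close>

text \<open>
  The fields \<open>E b = \<kappa> \<partial>\<^sub>b\<close> and the functions \<open>F b = \<kappa> (y\<^sub>b - c\<^sub>b)\<close> satisfy
  \<open>E a (F b) = \<kappa>(c)\<^sup>2 \<delta>\<^sub>a\<^sub>b\<close> at the point, since the derivative of \<open>\<kappa>\<close> is multiplied by \<open>y\<^sub>b - c\<^sub>b\<close>,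
  which vanishes there. Hence the values of the \<open>E b\<close> are independent, and by the dimension
  hypothesis they span the tangent space.
\<close>
lemma tangent_vector_extends:
  assumes B: "finite B" "span B = tangent_space A p" "card B = DIM('e)"
    and v: "v \<in> tangent_space A p"
  shows "\<exists>Z\<in>vector_fields A. Z p = v"
proof -
  obtain U \<psi> where U: "(U, \<psi>) \<in> A" and p: "p \<in> U" using chart_covers by blast
  define c where "c = \<psi> p"
  have "c \<in> \<psi> ` U" using p by (simp add: c_def)
  then obtain r where r: "r > 0" "cball c r \<subseteq> \<psi> ` U"
    using chart_props(2)[OF U] open_contains_cball by blast
  let ?\<kappa> = "bump c r"
  have \<kappa>: "smooth_on (\<psi> ` U) ?\<kappa>"
    using smooth_on_bump smooth_on_subset by blast
  define E where "E b = cutoff_partial A U \<psi> ?\<kappa> b" for b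
  define F where "F b = chart_extension U \<psi> (\<lambda>y. ?\<kappa> y * (y \<bullet> b + - (c \<bullet> b)))" for b
  have E: "E b \<in> vector_fields A" for b
    unfolding E_def
    by (rule cutoff_partial_vector_field[OF U \<kappa> compact_cball r(2) bump_eq_0[OF r(1)]])
  have F: "F b \<in> smooth_functions A" for b
    unfolding F_def
  proof (rule chart_extension_smooth[OF U _ compact_cball r(2)])
    show "smooth_on (\<psi> ` U) (\<lambda>y. ?\<kappa> y * (y \<bullet> b + - (c \<bullet> b)))"
      by (intro smooth_on_mult smooth_on_add smooth_on_const smooth_on_inner_right \<kappa> chart_props(2)[OF U])
  qed (simp add: bump_eq_0[OF r(1)])
  \<comment> \<open>biorthogonality of the cut-off coordinate fields and the cut-off coordinate functions\<close>
  have EF: "E a p (F b) = (?\<kappa> c)\<^sup>2 * (a \<bullet> b)" for a b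
  proof -
    have "(?\<kappa> has_derivative frechet_derivative ?\<kappa> (at c)) (at c)"
      by (rule smooth_on_has_derivative[OF smooth_on_bump UNIV_I])
    moreover have "((\<lambda>y. y \<bullet> b + - (c \<bullet> b)) has_derivative (\<lambda>w. w \<bullet> b)) (at c)"
      by (auto intro!: derivative_eq_intros)
    ultimately have "((\<lambda>y. ?\<kappa> y * (y \<bullet> b + - (c \<bullet> b))) has_derivative
      (\<lambda>w. ?\<kappa> c * (w \<bullet> b) + frechet_derivative ?\<kappa> (at c) w * (c \<bullet> b + - (c \<bullet> b)))) (at c)"
      by (rule has_derivative_mult)
    then have "((F b \<circ> inv_into U \<psi>) has_derivative
      (\<lambda>w. ?\<kappa> c * (w \<bullet> b) + frechet_derivative ?\<kappa> (at c) w * (c \<bullet> b + - (c \<bullet> b)))) (at c)"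
      by (rule has_derivative_transform_within_open[OF _ chart_props(2)[OF U] \<open>c \<in> \<psi> ` U\<close>])
         (auto simp: F_def chart_extension_def chart_props(4)[OF U])
    from fun_cong[OF frechet_derivative_at[OF this], of a] show ?thesis
      using F p by (simp add: E_def cutoff_partial_def chart_extension_def c_def[symmetric] power2_eq_square)
  qed
  have pos: "(?\<kappa> c)\<^sup>2 > 0" using bump_pos[OF r(1), of c] by simp
  have E_not_in: "E b p \<notin> span ((\<lambda>a. E a p) ` (Basis - {b}))" if "b \<in> Basis" for b
  proof
    assume "E b p \<in> span ((\<lambda>a. E a p) ` (Basis - {b}))"
    also have "span ((\<lambda>a. E a p) ` (Basis - {b})) \<subseteq> {w. w (F b) = 0}"
    proof (rule span_minimal)
      show "(\<lambda>a. E a p) ` (Basis - {b}) \<subseteq> {w. w (F b) = 0}"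
        using that by (auto simp: EF inner_Basis)
      show "subspace {w. w (F b) = 0}"
        by (auto simp: subspace_def scaleR_fun_def)
    qed
    finally show False
      using that pos by (simp add: EF)
  qed
  let ?E = "(\<lambda>b. E b p) ` Basis"
  have inj: "inj_on (\<lambda>b. E b p) Basis"
  proof (rule inj_onI, rule ccontr)
    fix a b :: 'e assume "a \<in> Basis" "b \<in> Basis" "E a p = E b p" "a \<noteq> b"
    then have "E b p \<in> (\<lambda>a. E a p) ` (Basis - {b})" by (metis DiffI imageI singletonD)
    from E_not_in[OF \<open>b \<in> Basis\<close>] span_base[OF this] show False by (rule notE)
  qed
  have ind: "independent ?E"
    unfolding dependent_def
  proof safe
    fix b :: 'e assume b: "b \<in> Basis" "E b p \<in> span (?E - {E b p})"
    have "?E - {E b p} \<subseteq> (\<lambda>a. E a p) ` (Basis - {b})" by auto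
    from b(2) span_mono[OF this] have "E b p \<in> span ((\<lambda>a. E a p) ` (Basis - {b}))" by (rule rev_subsetD)
    with E_not_in[OF b(1)] show False by (rule notE)
  qed
  have "v \<in> span ?E"
  proof (rule ccontr)
    assume "v \<notin> span ?E"
    then have "independent (insert v ?E)" and new: "v \<notin> ?E"
      using independent_insertI[OF _ ind] by (blast, meson span_base)
    moreover have "insert v ?E \<subseteq> span B"
      using v E B(2) vector_fields_tangent by auto
    ultimately have "card (insert v ?E) \<le> card B"
      using independent_span_bound[OF B(1)] by blast
    with new B(3) show False
      by (simp add: card_image[OF inj])
  qed
  also have "span ?E \<subseteq> (\<lambda>Z. Z p) ` vector_fields A"
  proof (rule span_minimal)
    show "subspace ((\<lambda>Z. Z p) ` vector_fields A)"
      unfolding subspace_def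
    proof safe
      show "0 \<in> (\<lambda>Z. Z p) ` vector_fields A"
        using vector_fields_0 by (rule rev_image_eqI) simp
      fix X Y assume X: "X \<in> vector_fields A" and Y: "Y \<in> vector_fields A"
      show "X p + Y p \<in> (\<lambda>Z. Z p) ` vector_fields A"
        using vector_fields_add[OF X Y] by (rule rev_image_eqI) simp
    next
      fix k :: real and X assume X: "X \<in> vector_fields A"
      show "k *\<^sub>R X p \<in> (\<lambda>Z. Z p) ` vector_fields A"
        using vector_fields_fscale[OF smooth_functions_const[of k] X]
        by (rule rev_image_eqI) (simp add: fscale_def)
    qed
  qed (use E in auto)
  finally show ?thesis by blast
qed

text \<open>
  Nondegeneracy at a point needs the pairing with every tangent vector there, whereas connections
  and exterior derivatives act on global vector fields; \<open>tangent_vector_extends\<close> is the bridge.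
\<close>
lemma vector_field_eq_0I:
  assumes g: "pseudo_riemannian_metric A r s g" and dim: "r + s = DIM('e)"
    and W: "W \<in> vector_fields A" and 0: "\<And>Z. Z \<in> vector_fields A \<Longrightarrow> ap2 g W Z = 0"
  shows "W = 0"
proof
  fix p
  have sig: "has_signature (tangent_space A p) (g p) r s"
    using g by (simp add: pseudo_riemannian_metric_def)
  then obtain P N where PN: "finite P" "finite N" "P \<inter> N = {}" "card P = r" "card N = s"
    and span: "span (P \<union> N) = tangent_space A p"
    unfolding has_signature_def by (elim exE conjE) (rule that)
  have card: "card (P \<union> N) = DIM('e)"
    using PN dim by (simp add: card_Un_disjoint)
  have "g p (W p) v = 0" if "v \<in> tangent_space A p" for v
  proof -
    from tangent_vector_extends[OF _ span card that] PN
    obtain Z where "Z \<in> vector_fields A" "Z p = v" by auto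
    then show ?thesis using fun_cong[OF 0, of Z p] by (simp add: ap2_def)
  qed
  then have "W p = 0"
    using g by (intro has_signature_nondegenerate[OF sig _ vector_fields_tangent[OF W]])
      (auto simp: pseudo_riemannian_metric_def tensor_0_2_def)
  then show "W p = 0 p" by simp
qed

end

section \<open>The structure tensors\<close>

locale almost_alpha_paracosymplectic_manifold =
  fixes A :: "('m::{t2_space, second_countable_topology}, 'e::euclidean_space) chart set"
    and n :: nat
    and \<phi> :: "'m \<Rightarrow> 'm tvec \<Rightarrow> 'm tvec"
    and \<xi> :: "'m vfield"
    and \<eta> :: "'m \<Rightarrow> 'm tvec \<Rightarrow> real"
    and g :: "'m \<Rightarrow> 'm tvec \<Rightarrow> 'm tvec \<Rightarrow> real"
    and \<alpha> :: "'m \<Rightarrow> real"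
    and D :: "'m vfield \<Rightarrow> 'm vfield \<Rightarrow> 'm vfield"
  assumes paracosymplectic: "almost_alpha_paracosymplectic A n \<phi> \<xi> \<eta> g \<alpha>"
    and levi_civita: "levi_civita_connection A g D"
begin

abbreviation metric_pairing ("\<langle>_, _\<rangle>") where
  "\<langle>X, Y\<rangle> \<equiv> ap2 g X Y"

text \<open>
  As \<open>\<nabla>\<close> is metric, this is \<open>(\<nabla>\<^sub>X \<Phi>)(Y, Z)\<close> for the fundamental form \<open>\<Phi>(Y, Z) = g(\<phi>Y, Z)\<close>.
\<close>
abbreviation cov_phi_form where
  "cov_phi_form X Y Z \<equiv> \<langle>cov_deriv_1_1 D \<phi> X Y, Z\<rangle>"

lemma paracontact: "almost_paracontact_metric A n \<phi> \<xi> \<eta> g"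
  using paracosymplectic unfolding almost_alpha_paracosymplectic_def by (elim conjE)

lemma atlas: "smooth_atlas A"
  using paracontact unfolding almost_paracontact_metric_def by simp

sublocale smooth_manifold A
  by unfold_locales (rule atlas)

lemma
  shows dimension: "DIM('e) = 2 * n + 1"
    and phi_tensor: "tensor_1_1 A \<phi>"
    and xi_field: "\<xi> \<in> vector_fields A"
    and eta_form: "one_form A \<eta>"
    and metric: "pseudo_riemannian_metric A (n + 1) n g"
  using paracontact unfolding almost_paracontact_metric_def by simp_all

lemma
  shows eta_xi_at: "\<eta> p (\<xi> p) = 1"
    and phi_phi_at: "v \<in> tangent_space A p \<Longrightarrow> \<phi> p (\<phi> p v) = v - \<eta> p v *\<^sub>R \<xi> p"
    and metric_phi_phi_at: "u \<in> tangent_space A p \<Longrightarrow> v \<in> tangent_space A p \<Longrightarrow>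
      g p (\<phi> p u) (\<phi> p v) = - g p u v + \<eta> p u * \<eta> p v"
  using paracontact unfolding almost_paracontact_metric_def by simp_all

lemma metric_tensor: "tensor_0_2 A g"
  and metric_sym_at: "u \<in> tangent_space A p \<Longrightarrow> v \<in> tangent_space A p \<Longrightarrow> g p u v = g p v u"
  using metric unfolding pseudo_riemannian_metric_def by simp_all

lemma phi_field: "X \<in> vector_fields A \<Longrightarrow> ap \<phi> X \<in> vector_fields A"
  using phi_tensor unfolding tensor_1_1_def by blast

lemma eta_smooth: "X \<in> vector_fields A \<Longrightarrow> ap \<eta> X \<in> smooth_functions A"
  using eta_form unfolding one_form_def by blast

lemma metric_smooth:
  "X \<in> vector_fields A \<Longrightarrow> Y \<in> vector_fields A \<Longrightarrow> \<langle>X, Y\<rangle> \<in> smooth_functions A"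
  using metric_tensor unfolding tensor_0_2_def by blast

lemma alpha_smooth: "\<alpha> \<in> smooth_functions A"
  using paracosymplectic unfolding almost_alpha_paracosymplectic_def by (elim conjE)

lemma phi_linear: "linear_map_on (tangent_space A p) (\<phi> p)"
  using phi_tensor unfolding tensor_1_1_def by blast

lemma eta_linear: "linear_map_on (tangent_space A p) (\<eta> p)"
  using eta_form unfolding one_form_def by blast

lemma metric_linear_left:
  "w \<in> tangent_space A p \<Longrightarrow> linear_map_on (tangent_space A p) (\<lambda>v. g p v w)"
  using metric_tensor unfolding tensor_0_2_def by blast

lemma phi_fscale:
  assumes "X \<in> vector_fields A"
  shows "ap \<phi> (a \<odot> X) = a \<odot> ap \<phi> X"
  using assms phi_linear vector_fields_tangent
  by (simp add: fun_eq_iff ap_def fscale_def linear_map_on_def)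

lemma phi_diff:
  "X \<in> vector_fields A \<Longrightarrow> Y \<in> vector_fields A \<Longrightarrow> ap \<phi> (X - Y) = ap \<phi> X - ap \<phi> Y"
  using linear_map_on_diff[OF phi_linear subspace_tangent_space] vector_fields_tangent
  by (simp add: fun_eq_iff ap_def)

lemma eta_diff:
  "X \<in> vector_fields A \<Longrightarrow> Y \<in> vector_fields A \<Longrightarrow> ap \<eta> (X - Y) = ap \<eta> X - ap \<eta> Y"
  using linear_map_on_diff[OF eta_linear subspace_tangent_space] vector_fields_tangent
  by (simp add: fun_eq_iff ap_def)

lemma metric_sym:
  "X \<in> vector_fields A \<Longrightarrow> Y \<in> vector_fields A \<Longrightarrow> \<langle>X, Y\<rangle> = \<langle>Y, X\<rangle>"
  using metric_sym_at vector_fields_tangent by (simp add: ap2_def)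

lemma metric_add_left:
  assumes "X \<in> vector_fields A" "Y \<in> vector_fields A" "Z \<in> vector_fields A"
  shows "\<langle>X + Y, Z\<rangle> = \<langle>X, Z\<rangle> + \<langle>Y, Z\<rangle>"
  using assms metric_linear_left vector_fields_tangent
  by (simp add: fun_eq_iff ap2_def linear_map_on_def)

lemma metric_fscale_left:
  assumes "X \<in> vector_fields A" "Z \<in> vector_fields A"
  shows "\<langle>a \<odot> X, Z\<rangle> = a * \<langle>X, Z\<rangle>"
  using assms metric_linear_left vector_fields_tangent
  by (simp add: fun_eq_iff ap2_def linear_map_on_def fscale_def)

lemma metric_diff_left:
  assumes "X \<in> vector_fields A" "Y \<in> vector_fields A" "Z \<in> vector_fields A"
  shows "\<langle>X - Y, Z\<rangle> = \<langle>X, Z\<rangle> - \<langle>Y, Z\<rangle>"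
  using assms linear_map_on_diff[OF metric_linear_left subspace_tangent_space] vector_fields_tangent
  by (simp add: fun_eq_iff ap2_def)

lemma phi_phi:
  "X \<in> vector_fields A \<Longrightarrow> ap \<phi> (ap \<phi> X) = X - ap \<eta> X \<odot> \<xi>"
  using phi_phi_at vector_fields_tangent by (simp add: fun_eq_iff ap_def fscale_def)

lemma eta_xi: "ap \<eta> \<xi> = 1"
  by (simp add: fun_eq_iff ap_def eta_xi_at)

lemma fscale_xi_eq_0:
  assumes "a \<odot> \<xi> = 0"
  shows "a = 0"
proof
  fix p
  have "\<eta> p (\<xi> p - \<xi> p) = 0"
    using linear_map_on_diff[OF eta_linear subspace_tangent_space vector_fields_tangent[OF xi_field]
        vector_fields_tangent[OF xi_field], of p] by simp
  then have "\<xi> p \<noteq> 0"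
    using eta_xi_at[of p] by auto
  moreover have "a p *\<^sub>R \<xi> p = 0"
    using fun_cong[OF assms, of p] by (simp add: fscale_def)
  ultimately show "a p = 0 p" by simp
qed

text \<open>
  Put \<open>a = \<eta>(\<phi>\<xi>)\<close>. Computing \<open>\<phi>\<^sup>3 \<xi>\<close> in two ways gives \<open>\<phi>\<xi> = a\<xi>\<close>, and applying \<open>\<phi>\<close> again gives
  \<open>a\<^sup>2 \<xi> = \<phi>\<^sup>2 \<xi> = 0\<close>.
\<close>
lemma phi_xi: "ap \<phi> \<xi> = 0"
proof -
  let ?a = "ap \<eta> (ap \<phi> \<xi>)"
  have sq: "ap \<phi> (ap \<phi> \<xi>) = 0"
    by (simp add: phi_phi[OF xi_field] eta_xi fscale_def fun_eq_iff)
  have zero: "ap \<phi> 0 = 0"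
    using phi_diff[OF xi_field xi_field] by simp
  have a: "ap \<phi> \<xi> = ?a \<odot> \<xi>"
    using phi_phi[OF phi_field[OF xi_field]] by (simp add: sq zero)
  then have "?a \<odot> ?a \<odot> \<xi> = 0"
    using sq phi_fscale[OF xi_field, of ?a] by metis
  moreover have "(?a * ?a) \<odot> \<xi> = ?a \<odot> ?a \<odot> \<xi>"
    by (simp add: fscale_def)
  ultimately have "?a * ?a = 0"
    using fscale_xi_eq_0 by metis
  then have "?a = 0" by (simp add: fun_eq_iff)
  with a show ?thesis by (simp add: fscale_def fun_eq_iff)
qed

text \<open>
  Both \<open>\<phi>\<^sup>2 (\<phi>X)\<close> and \<open>\<phi> (\<phi>\<^sup>2 X)\<close> can be computed from \<open>\<phi>\<^sup>2 = Id - \<eta> \<otimes> \<xi>\<close>; their difference is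
  \<open>\<eta>(\<phi>X) \<xi>\<close>.
\<close>
lemma eta_phi:
  assumes X: "X \<in> vector_fields A"
  shows "ap \<eta> (ap \<phi> X) = 0"
proof (rule fscale_xi_eq_0)
  let ?a = "ap \<eta> (ap \<phi> X)"
  have "ap \<phi> X - ?a \<odot> \<xi> = ap \<phi> (X - ap \<eta> X \<odot> \<xi>)"
    by (simp add: phi_phi[OF X, symmetric] phi_phi[OF phi_field[OF X], symmetric])
  also have "\<dots> = ap \<phi> X - ap \<eta> X \<odot> 0"
    using phi_diff[OF X vector_fields_fscale[OF eta_smooth[OF X] xi_field]]
    by (simp only: phi_fscale[OF xi_field] phi_xi)
  also have "\<dots> = ap \<phi> X"
    by (simp add: fscale_def fun_eq_iff)
  finally show "?a \<odot> \<xi> = 0" by simp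
qed

lemma metric_phi_phi:
  "X \<in> vector_fields A \<Longrightarrow> Y \<in> vector_fields A \<Longrightarrow>
    \<langle>ap \<phi> X, ap \<phi> Y\<rangle> = - \<langle>X, Y\<rangle> + ap \<eta> X * ap \<eta> Y"
  using metric_phi_phi_at vector_fields_tangent by (simp add: fun_eq_iff ap_def ap2_def)

lemma eta_metric:
  assumes X: "X \<in> vector_fields A"
  shows "ap \<eta> X = \<langle>X, \<xi>\<rangle>"
proof -
  have "\<langle>ap \<phi> X, 0\<rangle> = 0"
    using metric_sym[OF phi_field[OF X] vector_fields_0]
      metric_diff_left[OF xi_field xi_field phi_field[OF X]] by simp
  then show ?thesis
    using metric_phi_phi[OF X xi_field] by (simp add: phi_xi eta_xi)
qed

lemma phi_skew:
  assumes X: "X \<in> vector_fields A" and Y: "Y \<in> vector_fields A"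
  shows "\<langle>ap \<phi> X, Y\<rangle> = - \<langle>X, ap \<phi> Y\<rangle>"
proof -
  note \<phi>X = phi_field[OF X] and \<phi>Y = phi_field[OF Y]
  have "- \<langle>X, ap \<phi> Y\<rangle> = \<langle>ap \<phi> X, ap \<phi> (ap \<phi> Y)\<rangle>"
    by (simp add: metric_phi_phi[OF X \<phi>Y] eta_phi[OF Y])
  also have "\<dots> = \<langle>Y - ap \<eta> Y \<odot> \<xi>, ap \<phi> X\<rangle>"
    using metric_sym[OF \<phi>X phi_field[OF \<phi>Y]] by (simp add: phi_phi[OF Y])
  also have "\<dots> = \<langle>Y, ap \<phi> X\<rangle> - ap \<eta> Y * \<langle>\<xi>, ap \<phi> X\<rangle>"
    using metric_diff_left[OF Y vector_fields_fscale[OF eta_smooth[OF Y] xi_field] \<phi>X]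
    by (simp add: metric_fscale_left[OF xi_field \<phi>X])
  also have "\<langle>\<xi>, ap \<phi> X\<rangle> = 0"
    using metric_sym[OF xi_field \<phi>X] eta_metric[OF \<phi>X] eta_phi[OF X] by simp
  finally show ?thesis
    using metric_sym[OF \<phi>X Y] by (simp add: fun_eq_iff)
qed

section \<open>The covariant derivative of the structure\<close>

lemma act_uminus:
  assumes "X \<in> vector_fields A" "f \<in> smooth_functions A"
  shows "act X (- f) = - act X f"
proof
  fix p
  have "X p ((- 1) *\<^sub>R f) = (- 1) * X p f"
    using vector_fields_tangent[OF assms(1), of p] assms(2) unfolding tangent_space_def by blast
  then show "act X (- f) p = (- act X f) p" by (simp add: act_def)
qed

lemma act_smooth:
  "X \<in> vector_fields A \<Longrightarrow> f \<in> smooth_functions A \<Longrightarrow> act X f \<in> smooth_functions A"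
  by (simp add: vector_fields_def)

lemma connection_field:
  "X \<in> vector_fields A \<Longrightarrow> Y \<in> vector_fields A \<Longrightarrow> D X Y \<in> vector_fields A"
  using levi_civita unfolding levi_civita_connection_def affine_connection_def by simp

lemma connection_add:
  "X \<in> vector_fields A \<Longrightarrow> Y \<in> vector_fields A \<Longrightarrow> Z \<in> vector_fields A \<Longrightarrow>
    D X (Y + Z) = D X Y + D X Z"
  using levi_civita unfolding levi_civita_connection_def affine_connection_def by simp

lemma connection_leibniz:
  "a \<in> smooth_functions A \<Longrightarrow> X \<in> vector_fields A \<Longrightarrow> Y \<in> vector_fields A \<Longrightarrow>
    D X (a \<odot> Y) = act X a \<odot> Y + a \<odot> D X Y"
  using levi_civita unfolding levi_civita_connection_def affine_connection_def by simp

lemma connection_torsion_free: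
  "X \<in> vector_fields A \<Longrightarrow> Y \<in> vector_fields A \<Longrightarrow> lie_bracket X Y = D X Y - D Y X"
  using levi_civita unfolding levi_civita_connection_def by simp

lemma connection_metric:
  "X \<in> vector_fields A \<Longrightarrow> Y \<in> vector_fields A \<Longrightarrow> Z \<in> vector_fields A \<Longrightarrow>
    act X \<langle>Y, Z\<rangle> = \<langle>D X Y, Z\<rangle> + \<langle>Y, D X Z\<rangle>"
  using levi_civita unfolding levi_civita_connection_def by simp

lemma connection_0: "X \<in> vector_fields A \<Longrightarrow> D X 0 = 0"
  using connection_add[OF _ vector_fields_0 vector_fields_0, of X] by simp

lemma cov_phi_form_eq:
  assumes "X \<in> vector_fields A" "Y \<in> vector_fields A" "Z \<in> vector_fields A"
  shows "cov_phi_form X Y Z = \<langle>D X (ap \<phi> Y), Z\<rangle> - \<langle>ap \<phi> (D X Y), Z\<rangle>"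
  using assms metric_diff_left connection_field phi_field by (simp add: cov_deriv_1_1_def)

text \<open>
  The form \<open>g(\<phi>Y, Z)\<close> is skew in \<open>Y\<close> and \<open>Z\<close>, and hence so is its covariant derivative along \<open>X\<close>.
\<close>
lemma cov_phi_form_skew:
  assumes X: "X \<in> vector_fields A" and Y: "Y \<in> vector_fields A" and Z: "Z \<in> vector_fields A"
  shows "cov_phi_form X Z Y = - cov_phi_form X Y Z"
proof -
  note vf = X Y Z phi_field connection_field
  have "act X \<langle>ap \<phi> Z, Y\<rangle> = - act X \<langle>ap \<phi> Y, Z\<rangle>"
    using act_uminus[OF X metric_smooth[of "ap \<phi> Y" Z]] phi_skew[OF Z Y] metric_sym[of Z "ap \<phi> Y"]
    by (simp add: vf)
  then have 1: "\<langle>D X (ap \<phi> Z), Y\<rangle> + \<langle>ap \<phi> Z, D X Y\<rangle> = - (\<langle>D X (ap \<phi> Y), Z\<rangle> + \<langle>ap \<phi> Y, D X Z\<rangle>)"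
    by (simp add: connection_metric vf)
  have 2: "\<langle>ap \<phi> (D X Y), Z\<rangle> = - \<langle>ap \<phi> Z, D X Y\<rangle>" "\<langle>ap \<phi> (D X Z), Y\<rangle> = - \<langle>ap \<phi> Y, D X Z\<rangle>"
    using phi_skew[of "D X Y" Z] metric_sym[of "D X Y" "ap \<phi> Z"]
      phi_skew[of "D X Z" Y] metric_sym[of "D X Z" "ap \<phi> Y"] by (simp_all add: vf)
  show ?thesis
  proof
    fix p
    show "cov_phi_form X Z Y p = (- cov_phi_form X Y Z) p"
      using fun_cong[OF 1, of p] 2[THEN fun_cong, of p] by (simp add: cov_phi_form_eq vf)
  qed
qed

text \<open>
  Since \<open>\<eta> = g(\<cdot>, \<xi>)\<close> and \<open>\<nabla>\<close> is torsion-free and metric, \<open>d\<eta>(X, Y)\<close> is the difference of the two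
  sides.
\<close>
lemma connection_xi_self_adjoint:
  assumes X: "X \<in> vector_fields A" and Y: "Y \<in> vector_fields A"
  shows "\<langle>D X \<xi>, Y\<rangle> = \<langle>D Y \<xi>, X\<rangle>"
proof -
  have "ext_deriv_1 \<eta> X Y = 0"
    using paracosymplectic X Y unfolding almost_alpha_paracosymplectic_def by simp
  then have 1: "act X \<langle>Y, \<xi>\<rangle> - act Y \<langle>X, \<xi>\<rangle> = \<langle>D X Y, \<xi>\<rangle> - \<langle>D Y X, \<xi>\<rangle>"
    using connection_field[OF X Y] connection_field[OF Y X]
    by (simp add: ext_deriv_1_def connection_torsion_free[OF X Y] eta_diff eta_metric X Y)
  have 2: "act X \<langle>Y, \<xi>\<rangle> = \<langle>D X Y, \<xi>\<rangle> + \<langle>D X \<xi>, Y\<rangle>" "act Y \<langle>X, \<xi>\<rangle> = \<langle>D Y X, \<xi>\<rangle> + \<langle>D Y \<xi>, X\<rangle>"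
    using metric_sym[of Y "D X \<xi>"] metric_sym[of X "D Y \<xi>"]
    by (simp_all add: connection_metric connection_field X Y xi_field)
  show ?thesis
    using 1 unfolding 2 by (simp add: algebra_simps)
qed

text \<open>
  This is the covariant derivative of \<open>\<phi>\<^sup>2 = Id - \<eta> \<otimes> \<xi>\<close>, that is
  \<open>(\<nabla>\<^sub>X \<phi>) \<phi>Y + \<phi> (\<nabla>\<^sub>X \<phi>) Y = - (\<nabla>\<^sub>X \<eta>)(Y) \<xi> - \<eta>(Y) \<nabla>\<^sub>X \<xi>\<close>, paired with \<open>Z\<close>; the second term on the
  left becomes \<open>- g((\<nabla>\<^sub>X \<phi>) Y, \<phi>Z)\<close>, as \<open>\<phi>\<close> is skew.
\<close>
lemma cov_phi_form_phi_middle: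
  assumes X: "X \<in> vector_fields A" and Y: "Y \<in> vector_fields A" and Z: "Z \<in> vector_fields A"
  shows "cov_phi_form X (ap \<phi> Y) Z =
    cov_phi_form X Y (ap \<phi> Z) - \<langle>D X \<xi>, Y\<rangle> * ap \<eta> Z - ap \<eta> Y * \<langle>D X \<xi>, Z\<rangle>"
proof -
  note vf = X Y Z xi_field phi_field connection_field vector_fields_fscale eta_smooth
  \<comment> \<open>the equation for the square of \<open>\<phi>\<close>, with the subtracted term moved to the other side\<close>
  have "D X (ap \<phi> (ap \<phi> Y)) + D X (ap \<eta> Y \<odot> \<xi>) = D X Y"
    using connection_add[OF X phi_field[OF phi_field[OF Y]], of "ap \<eta> Y \<odot> \<xi>"] by (simp add: vf phi_phi)
  then have 1: "\<langle>D X (ap \<phi> (ap \<phi> Y)), Z\<rangle> + \<langle>D X (ap \<eta> Y \<odot> \<xi>), Z\<rangle> = \<langle>D X Y, Z\<rangle>"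
    using metric_add_left[of "D X (ap \<phi> (ap \<phi> Y))" "D X (ap \<eta> Y \<odot> \<xi>)" Z] by (simp add: vf)
  have "\<langle>D X (ap \<eta> Y \<odot> \<xi>), Z\<rangle> = act X (ap \<eta> Y) * \<langle>\<xi>, Z\<rangle> + ap \<eta> Y * \<langle>D X \<xi>, Z\<rangle>"
    using metric_add_left[of "act X (ap \<eta> Y) \<odot> \<xi>" "ap \<eta> Y \<odot> D X \<xi>" Z]
    by (simp add: connection_leibniz metric_fscale_left act_smooth vf)
  moreover have "\<langle>\<xi>, Z\<rangle> = ap \<eta> Z"
    by (simp add: eta_metric metric_sym vf)
  moreover have "act X (ap \<eta> Y) = ap \<eta> (D X Y) + \<langle>D X \<xi>, Y\<rangle>"
    using metric_sym[of Y "D X \<xi>"] by (simp add: eta_metric connection_metric vf)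
  ultimately have 2: "\<langle>D X (ap \<eta> Y \<odot> \<xi>), Z\<rangle> =
      (ap \<eta> (D X Y) + \<langle>D X \<xi>, Y\<rangle>) * ap \<eta> Z + ap \<eta> Y * \<langle>D X \<xi>, Z\<rangle>"
    by (simp only:)
  have 3: "\<langle>ap \<phi> (D X Y), ap \<phi> Z\<rangle> = - \<langle>D X Y, Z\<rangle> + ap \<eta> (D X Y) * ap \<eta> Z"
    by (simp add: metric_phi_phi vf)
  have 4: "\<langle>ap \<phi> (D X (ap \<phi> Y)), Z\<rangle> = - \<langle>D X (ap \<phi> Y), ap \<phi> Z\<rangle>"
    by (simp add: phi_skew vf)
  show ?thesis
  proof
    fix p
    show "cov_phi_form X (ap \<phi> Y) Z p =
        (cov_phi_form X Y (ap \<phi> Z) - \<langle>D X \<xi>, Y\<rangle> * ap \<eta> Z - ap \<eta> Y * \<langle>D X \<xi>, Z\<rangle>) p"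
      using 1[THEN fun_cong, of p] 2[THEN fun_cong, of p] 3[THEN fun_cong, of p] 4[THEN fun_cong, of p]
      by (simp add: cov_phi_form_eq vf algebra_simps)
  qed
qed

text \<open>
  By skewness it is enough to differentiate \<open>\<phi>\<xi> = 0\<close>.
\<close>
lemma cov_phi_form_xi:
  assumes X: "X \<in> vector_fields A" and Y: "Y \<in> vector_fields A"
  shows "cov_phi_form X Y \<xi> = - \<langle>D X \<xi>, ap \<phi> Y\<rangle>"
proof -
  have "\<langle>0, Y\<rangle> = 0"
    using metric_diff_left[OF X X Y] by simp
  then have "cov_phi_form X \<xi> Y = - \<langle>ap \<phi> (D X \<xi>), Y\<rangle>"
    by (simp add: cov_phi_form_eq[OF X xi_field Y] phi_xi connection_0[OF X])
  also have "\<dots> = \<langle>D X \<xi>, ap \<phi> Y\<rangle>"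
    by (simp add: phi_skew[OF connection_field[OF X xi_field] Y])
  finally show ?thesis using cov_phi_form_skew[OF X xi_field Y] by simp
qed

text \<open>
  Moving \<open>\<phi>\<close> from the second slot to the third produces \<open>\<phi>\<^sup>2 Z = Z - \<eta>(Z) \<xi>\<close> there.
\<close>
lemma cov_phi_form_phi_phi:
  assumes X: "X \<in> vector_fields A" and Y: "Y \<in> vector_fields A" and Z: "Z \<in> vector_fields A"
  shows "cov_phi_form X (ap \<phi> Y) (ap \<phi> Z) =
    cov_phi_form X Y Z + ap \<eta> Z * \<langle>D X \<xi>, ap \<phi> Y\<rangle> - ap \<eta> Y * \<langle>D X \<xi>, ap \<phi> Z\<rangle>"
proof -
  note vf = X Y Z xi_field phi_field connection_field vector_fields_fscale eta_smooth
  let ?C = "cov_deriv_1_1 D \<phi> X Y"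
  have C: "?C \<in> vector_fields A"
    by (simp add: cov_deriv_1_1_def vector_fields_diff vf)
  have "\<langle>?C, ap \<phi> (ap \<phi> Z)\<rangle> = \<langle>Z, ?C\<rangle> - ap \<eta> Z * \<langle>\<xi>, ?C\<rangle>"
    using metric_diff_left[of Z "ap \<eta> Z \<odot> \<xi>" ?C] metric_sym[OF C phi_field[OF phi_field[OF Z]]]
    by (simp add: phi_phi metric_fscale_left C vf)
  also have "\<dots> = \<langle>?C, Z\<rangle> + ap \<eta> Z * \<langle>D X \<xi>, ap \<phi> Y\<rangle>"
    by (simp add: metric_sym[OF Z C] metric_sym[OF xi_field C] cov_phi_form_xi[OF X Y])
  finally show ?thesis
    using cov_phi_form_phi_middle[OF X Y phi_field[OF Z]] by (simp add: eta_phi Z)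
qed

text \<open>
  For a torsion-free connection, \<open>d\<Phi>\<close> is the cyclic sum of \<open>\<nabla>\<Phi>\<close>: after
  \<open>X (\<Phi>(Y, Z)) = (\<nabla>\<^sub>X \<Phi>)(Y, Z) + \<Phi>(\<nabla>\<^sub>X Y, Z) + \<Phi>(Y, \<nabla>\<^sub>X Z)\<close> the bracket terms cancel the rest.
\<close>
lemma cov_phi_form_cyclic:
  assumes X: "X \<in> vector_fields A" and Y: "Y \<in> vector_fields A" and Z: "Z \<in> vector_fields A"
  shows "cov_phi_form X Y Z + cov_phi_form Y Z X + cov_phi_form Z X Y =
    2 *\<^sub>R (\<alpha> * (ap \<eta> X * \<langle>ap \<phi> Y, Z\<rangle> + ap \<eta> Y * \<langle>ap \<phi> Z, X\<rangle> + ap \<eta> Z * \<langle>ap \<phi> X, Y\<rangle>))"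
proof -
  note vf = phi_field connection_field
  have \<Phi>: "ap2 (fundamental_form \<phi> g) U V = \<langle>ap \<phi> U, V\<rangle>" for U V
    by (simp add: ap2_def ap_def fundamental_form_def)
  have d: "ext_deriv_2 (fundamental_form \<phi> g) X Y Z =
      2 *\<^sub>R (\<alpha> * wedge_1_2 \<eta> (fundamental_form \<phi> g) X Y Z)"
    using paracosymplectic X Y Z unfolding almost_alpha_paracosymplectic_def by simp
  have skew: "\<langle>ap \<phi> U, V\<rangle> = - \<langle>ap \<phi> V, U\<rangle>" if "U \<in> vector_fields A" "V \<in> vector_fields A" for U V
    using phi_skew[OF that] metric_sym[OF that(1) phi_field[OF that(2)]] by simp
  have act: "act U \<langle>ap \<phi> V, W\<rangle> = cov_phi_form U V W + \<langle>ap \<phi> (D U V), W\<rangle> - \<langle>ap \<phi> (D U W), V\<rangle>"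
    if "U \<in> vector_fields A" "V \<in> vector_fields A" "W \<in> vector_fields A" for U V W
    using that skew[of V "D U W"] by (simp add: connection_metric cov_phi_form_eq vf)
  have bracket: "\<langle>ap \<phi> (lie_bracket U V), W\<rangle> = \<langle>ap \<phi> (D U V), W\<rangle> - \<langle>ap \<phi> (D V U), W\<rangle>"
    if "U \<in> vector_fields A" "V \<in> vector_fields A" "W \<in> vector_fields A" for U V W
    using that by (simp add: connection_torsion_free phi_diff metric_diff_left vf)
  show ?thesis
  proof
    fix p
    show "(cov_phi_form X Y Z + cov_phi_form Y Z X + cov_phi_form Z X Y) p =
      (2 *\<^sub>R (\<alpha> * (ap \<eta> X * \<langle>ap \<phi> Y, Z\<rangle> + ap \<eta> Y * \<langle>ap \<phi> Z, X\<rangle> + ap \<eta> Z * \<langle>ap \<phi> X, Y\<rangle>))) p"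
      using fun_cong[OF d, of p] cov_phi_form_skew[OF Y X Z, THEN fun_cong, of p]
        skew[OF X Z, THEN fun_cong, of p]
      by (simp add: ext_deriv_2_def wedge_1_2_def \<Phi> act bracket X Y Z scaleR_fun_def algebra_simps)
  qed
qed

text \<open>
  With \<open>S\<close> the cyclic sum of \<^term>\<open>cov_phi_form\<close>, the identity is half of the equation for
  \<open>S(\<phi>X, \<phi>Y, Z) + S(\<phi>X, Y, \<phi>Z) - S(X, \<phi>Y, \<phi>Z) - S(X, Y, Z)\<close>. In the twelve terms, moving \<open>\<phi>\<close>
  between the last two slots identifies those along \<open>\<phi>X\<close> and those along \<open>X\<close> with each other and
  cancels the other eight in pairs; the corrections involve only \<open>\<nabla>\<xi>\<close>.
\<close>
lemma cov_phi_form_phi_conjugate: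
  assumes X: "X \<in> vector_fields A" and Y: "Y \<in> vector_fields A" and Z: "Z \<in> vector_fields A"
  shows "cov_phi_form (ap \<phi> X) (ap \<phi> Y) Z = cov_phi_form X Y Z - ap \<eta> Y * \<langle>D (ap \<phi> X) \<xi>, Z\<rangle>
    + 2 *\<^sub>R \<alpha> * (\<langle>X, ap \<phi> Y\<rangle> * ap \<eta> Z + ap \<eta> Y * \<langle>ap \<phi> X, Z\<rangle>)"
proof
  fix p
  note \<phi>X = phi_field[OF X] and \<phi>Y = phi_field[OF Y] and \<phi>Z = phi_field[OF Z]
  have \<phi>\<phi>: "\<langle>ap \<phi> (ap \<phi> U), ap \<phi> V\<rangle> = - \<langle>ap \<phi> U, V\<rangle>" if "U \<in> vector_fields A" "V \<in> vector_fields A" for U V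
    by (simp add: metric_phi_phi[OF phi_field[OF that(1)] that(2)] eta_phi[OF that(1)])
  have "\<langle>X, ap \<phi> Y\<rangle> = - \<langle>ap \<phi> X, Y\<rangle>" "\<langle>ap \<phi> Z, X\<rangle> = - \<langle>ap \<phi> X, Z\<rangle>"
    using phi_skew[OF X Y] phi_skew[OF Z X] metric_sym[OF Z \<phi>X] by simp_all
  note skew = this[THEN fun_cong, of p]
  \<comment> \<open>the four cyclic sums of the combination, with coefficients \<open>1, 1, -1, -1\<close>\<close>
  note cyclic = cov_phi_form_cyclic[OF \<phi>X \<phi>Y Z] cov_phi_form_cyclic[OF \<phi>X Y \<phi>Z]
    cov_phi_form_cyclic[OF X \<phi>Y \<phi>Z] cov_phi_form_cyclic[OF X Y Z]
  note cyclic = cyclic[unfolded eta_phi[OF X] eta_phi[OF Y] eta_phi[OF Z] \<phi>\<phi>[OF X Y] \<phi>\<phi>[OF Z X] \<phi>\<phi>[OF Y Z],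
    THEN fun_cong, of p]
  \<comment> \<open>one relation for each pair of terms along \<open>\<phi>X\<close>, \<open>\<phi>Y\<close>, \<open>\<phi>Z\<close>, \<open>X\<close>, \<open>Y\<close> and \<open>Z\<close>\<close>
  note move = cov_phi_form_phi_middle[OF \<phi>X Y Z] cov_phi_form_phi_middle[OF \<phi>Y Z X]
    cov_phi_form_phi_middle[OF \<phi>Z X Y]
    cov_phi_form_phi_phi[OF X Y Z] cov_phi_form_phi_phi[OF Y Z X] cov_phi_form_phi_phi[OF Z X Y]
  note move' = move[THEN fun_cong, of p]
  note adj = connection_xi_self_adjoint[OF X \<phi>Y] connection_xi_self_adjoint[OF X \<phi>Z]
    connection_xi_self_adjoint[OF Y \<phi>X] connection_xi_self_adjoint[OF Y \<phi>Z]
    connection_xi_self_adjoint[OF Z \<phi>X] connection_xi_self_adjoint[OF Z \<phi>Y]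
  note adj = adj[THEN fun_cong, of p]
  show "cov_phi_form (ap \<phi> X) (ap \<phi> Y) Z p = (cov_phi_form X Y Z - ap \<eta> Y * \<langle>D (ap \<phi> X) \<xi>, Z\<rangle>
    + 2 *\<^sub>R \<alpha> * (\<langle>X, ap \<phi> Y\<rangle> * ap \<eta> Z + ap \<eta> Y * \<langle>ap \<phi> X, Z\<rangle>)) p"
    using cyclic move' unfolding plus_fun_apply times_fun_apply minus_apply uminus_apply zero_fun_apply
      scaleR_fun_def adj skew
    by (simp add: algebra_simps)
qed

lemma cov_deriv_phi_conjugate:
  assumes X: "X \<in> vector_fields A" and Y: "Y \<in> vector_fields A"
  shows "cov_deriv_1_1 D \<phi> (ap \<phi> X) (ap \<phi> Y) - cov_deriv_1_1 D \<phi> X Y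
           - ap \<eta> Y \<odot> shape_operator D \<xi> (ap \<phi> X)
           - (2 *\<^sub>R \<alpha>) \<odot> (\<langle>X, ap \<phi> Y\<rangle> \<odot> \<xi> + ap \<eta> Y \<odot> ap \<phi> X) = 0" (is "?W = 0")
proof (rule vector_field_eq_0I[OF metric])
  show "(n + 1) + n = DIM('e)" using dimension by simp
  have C: "cov_deriv_1_1 D \<phi> U V \<in> vector_fields A"
    if "U \<in> vector_fields A" "V \<in> vector_fields A" for U V
    using that by (simp add: cov_deriv_1_1_def vector_fields_diff phi_field connection_field)
  note vf = X Y xi_field phi_field connection_field vector_fields_fscale vector_fields_add
    vector_fields_diff vector_fields_uminus eta_smooth metric_smooth smooth_functions_scaleR alpha_smooth C
  have W: "?W = cov_deriv_1_1 D \<phi> (ap \<phi> X) (ap \<phi> Y) - cov_deriv_1_1 D \<phi> X Y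
           - ap \<eta> Y \<odot> (- D (ap \<phi> X) \<xi>)
           - (2 *\<^sub>R \<alpha>) \<odot> (\<langle>X, ap \<phi> Y\<rangle> \<odot> \<xi> + ap \<eta> Y \<odot> ap \<phi> X)"
    by (simp add: shape_operator_def)
  show "?W \<in> vector_fields A"
    unfolding W by (simp add: vf)
  fix Z assume Z: "Z \<in> vector_fields A"
  have neg: "\<langle>- D (ap \<phi> X) \<xi>, Z\<rangle> = - \<langle>D (ap \<phi> X) \<xi>, Z\<rangle>"
    using metric_diff_left[of 0 "D (ap \<phi> X) \<xi>" Z] metric_diff_left[OF X X Z] by (simp add: vf Z vector_fields_0)
  have xi: "\<langle>\<xi>, Z\<rangle> = ap \<eta> Z"
    using metric_sym[OF xi_field Z] eta_metric[OF Z] by simp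
  show "\<langle>?W, Z\<rangle> = 0"
    unfolding W
    by (simp add: metric_diff_left metric_add_left metric_fscale_left neg xi vf Z
        cov_phi_form_phi_conjugate[OF X Y Z] algebra_simps)
qed

end

theorem proposition6:
  fixes A :: "('m::{t2_space, second_countable_topology}, 'e::euclidean_space) chart set"
    and n :: nat
    and \<phi> :: "'m \<Rightarrow> 'm tvec \<Rightarrow> 'm tvec"
    and \<xi> X Y :: "'m vfield"
    and \<eta> :: "'m \<Rightarrow> 'm tvec \<Rightarrow> real"
    and g :: "'m \<Rightarrow> 'm tvec \<Rightarrow> 'm tvec \<Rightarrow> real"
    and \<alpha> :: "'m \<Rightarrow> real"
    and D :: "'m vfield \<Rightarrow> 'm vfield \<Rightarrow> 'm vfield"
  assumes "almost_alpha_paracosymplectic A n \<phi> \<xi> \<eta> g \<alpha>"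
    and "levi_civita_connection A g D"
    and "X \<in> vector_fields A" and "Y \<in> vector_fields A"
  shows "cov_deriv_1_1 D \<phi> (ap \<phi> X) (ap \<phi> Y) - cov_deriv_1_1 D \<phi> X Y
           - ap \<eta> Y \<odot> shape_operator D \<xi> (ap \<phi> X)
           - (2 *\<^sub>R \<alpha>) \<odot> (ap2 g X (ap \<phi> Y) \<odot> \<xi> + ap \<eta> Y \<odot> ap \<phi> X) = 0"
proof -
  interpret almost_alpha_paracosymplectic_manifold A n \<phi> \<xi> \<eta> g \<alpha> D
    using assms(1,2) by unfold_locales
  show ?thesis
    by (rule cov_deriv_phi_conjugate[OF assms(3,4)])
qed

end
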